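(* Let $t>0$ and let $A \in \mathcal L(F_t^2)$. Then $A \in C_R(F_t^2)$ if and only if $\mathfrak M(A) \in \operatorname{BDO}(\ell^2(\mathbb N_0))$.
   Context: For $t>0$, $F_t^2$ is the Fock space: the Hilbert space of entire functions on $\mathbb C$ that lie in $L^2(\mathbb C,\mu_t)$, where $d\mu_t(z)=\frac{1}{\pi t}e^{-|z|^2/t}\,dz$ ($dz$ is Lebesgue area measure), with inner product $\langle f,g\rangle_t=\int_{\mathbb C} f\overline g\,d\mu_t$. $\mathcal L(\mathcal H)$ denotes the bounded linear operators on a Hilbert space $\mathcal H$. For $\zeta$ in the unit circle $\mathbb T\subset\mathbb C$, $U_\zeta$ is the unitary operator on $F_t^2$ given by $U_\zeta g(z)=g(\zeta z)$. Define $$C_R(F_t^2)=\{A\in\mathcal L(F_t^2):\ \|U_\zeta A U_\zeta^*-A\|_{op}\to 0 \text{ as } \zeta\to 1,\ \zeta\in\mathbb T\}.$$ The standard orthonormal basis of $F_t^2$ is $e_n^t(z)=\frac{1}{\sqrt{n!\,t^n}}z^n$, $n\in\mathbb N_0$. For $A\in\mathcal L(F_t^2)$, $\mathfrak M(A)\in\mathcal L(\ell^2(\mathbb N_0))$ is the operator corresponding to $A$ under the unitary identification of $e_n^t$ with the $n$-th standard basis vector of $\ell^2(\mathbb N_0)$, i.e. the operator with matrix coefficients $\langle Ae_m^t,e_n^t\rangle_t$, $m,n\in\mathbb N_0$. For $k\in\mathbb Z$, $\operatorname{band}_k$ is the set of $\mathfrak M(C)\in\mathcal L(\ell^2(\mathbb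 N_0))$ with $\langle Ce_m^t,e_n^t\rangle_t=0$ unless $m-n=k$. The algebraic sum $\bigoplus_{k\in\mathbb Z}\operatorname{band}_k$ (finite sums) is the algebra of band operators, and $\operatorname{BDO}(\ell^2(\mathbb N_0))$ (band-dominated operators) is its operator norm closure in $\mathcal L(\ell^2(\mathbb N_0))$. *)

theory Defs
  imports "HOL-Complex_Analysis.Complex_Analysis"
begin

text \<open>
  A Hilbert space is given by a carrier \<open>H\<close>, a set of complex-valued functions closed under the
  pointwise vector space operations, together with a norm \<open>N\<close> or an inner product \<open>ip\<close> on it.
  An operator on it is a function on the ambient type of which only the restriction to \<open>H\<close> matters.
\<close>

definition bounded_ops ::
  "('a \<Rightarrow> complex) set \<Rightarrow> (('a \<Rightarrow> complex) \<Rightarrow> real) \<Rightarrow> (('a \<Rightarrow> complex) \<Rightarrow> ('a \<Rightarrow> complex)) set"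
  where "bounded_ops H N = {A.
     (\<forall>f\<in>H. A f \<in> H) \<and>
     (\<forall>f\<in>H. \<forall>g\<in>H. A (\<lambda>z. f z + g z) = (\<lambda>z. A f z + A g z)) \<and>
     (\<forall>c. \<forall>f\<in>H. A (\<lambda>z. c * f z) = (\<lambda>z. c * A f z)) \<and>
     (\<exists>K. \<forall>f\<in>H. N (A f) \<le> K * N f)}"

definition op_norm ::
  "('a \<Rightarrow> complex) set \<Rightarrow> (('a \<Rightarrow> complex) \<Rightarrow> real) \<Rightarrow> (('a \<Rightarrow> complex) \<Rightarrow> ('a \<Rightarrow> complex)) \<Rightarrow> real"
  where "op_norm H N A = (SUP f\<in>{f\<in>H. N f \<le> 1}. N (A f))"

definition adjoint_op ::
  "('a \<Rightarrow> complex) set \<Rightarrow> (('a \<Rightarrow> complex) \<Rightarrow> ('a \<Rightarrow> complex) \<Rightarrow> complex)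
    \<Rightarrow> (('a \<Rightarrow> complex) \<Rightarrow> ('a \<Rightarrow> complex)) \<Rightarrow> (('a \<Rightarrow> complex) \<Rightarrow> ('a \<Rightarrow> complex))"
  where "adjoint_op H ip A = (\<lambda>g. THE h. h \<in> H \<and> (\<forall>f\<in>H. ip (A f) g = ip f h))"

definition gauss_measure :: "real \<Rightarrow> complex measure"
  where "gauss_measure t =
    density lborel (\<lambda>z. ennreal (1 / (pi * t) * exp (- (cmod z)\<^sup>2 / t)))"

definition fock :: "real \<Rightarrow> (complex \<Rightarrow> complex) set"
  where "fock t =
    {f. f holomorphic_on UNIV \<and> integrable (gauss_measure t) (\<lambda>z. (cmod (f z))\<^sup>2)}"

definition fock_inner :: "real \<Rightarrow> (complex \<Rightarrow> complex) \<Rightarrow> (complex \<Rightarrow> complex) \<Rightarrow> complex"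
  where "fock_inner t f g = (LINT z|gauss_measure t. f z * cnj (g z))"

definition fock_norm :: "real \<Rightarrow> (complex \<Rightarrow> complex) \<Rightarrow> real"
  where "fock_norm t f = sqrt (LINT z|gauss_measure t. (cmod (f z))\<^sup>2)"

abbreviation fock_ops :: "real \<Rightarrow> ((complex \<Rightarrow> complex) \<Rightarrow> (complex \<Rightarrow> complex)) set"
  where "fock_ops t \<equiv> bounded_ops (fock t) (fock_norm t)"

definition rot :: "complex \<Rightarrow> (complex \<Rightarrow> complex) \<Rightarrow> (complex \<Rightarrow> complex)"
  where "rot \<zeta> g = (\<lambda>z. g (\<zeta> * z))"

definition C_R :: "real \<Rightarrow> ((complex \<Rightarrow> complex) \<Rightarrow> (complex \<Rightarrow> complex)) set"
  where "C_R t = {A \<in> fock_ops t.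
    ((\<lambda>\<zeta>. op_norm (fock t) (fock_norm t)
        (\<lambda>f z. rot \<zeta> (A (adjoint_op (fock t) (fock_inner t) (rot \<zeta>) f)) z - A f z))
      \<longlongrightarrow> 0) (at 1 within sphere 0 1)}"

definition fock_basis :: "real \<Rightarrow> nat \<Rightarrow> complex \<Rightarrow> complex"
  where "fock_basis t n = (\<lambda>z. z ^ n / complex_of_real (sqrt (fact n * t ^ n)))"

definition ell2 :: "(nat \<Rightarrow> complex) set"
  where "ell2 = {x. summable (\<lambda>n. (cmod (x n))\<^sup>2)}"

definition ell2_norm :: "(nat \<Rightarrow> complex) \<Rightarrow> real"
  where "ell2_norm x = sqrt (\<Sum>n. (cmod (x n))\<^sup>2)"

abbreviation ell2_ops :: "((nat \<Rightarrow> complex) \<Rightarrow> (nat \<Rightarrow> complex)) set"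
  where "ell2_ops \<equiv> bounded_ops ell2 ell2_norm"

text \<open>
  For \<open>t > 0\<close> this is the unitary map of \<open>fock t\<close> onto \<open>ell2\<close> that sends the orthonormal basis
  \<open>fock_basis t\<close> to the standard one.
\<close>

definition fock_coords :: "real \<Rightarrow> (complex \<Rightarrow> complex) \<Rightarrow> (nat \<Rightarrow> complex)"
  where "fock_coords t f = (\<lambda>n. fock_inner t f (fock_basis t n))"

definition matrix_op ::
  "real \<Rightarrow> ((complex \<Rightarrow> complex) \<Rightarrow> (complex \<Rightarrow> complex)) \<Rightarrow> ((nat \<Rightarrow> complex) \<Rightarrow> (nat \<Rightarrow> complex))"
  where "matrix_op t A = (\<lambda>x. fock_coords t (A (inv_into (fock t) (fock_coords t) x)))"

text \<open>
  The parameter \<open>t > 0\<close> of the following sets only enters through the identification of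
  \<open>fock t\<close> with \<open>ell2\<close>; as operators on \<open>ell2\<close> their elements do not depend on it.
\<close>

definition band :: "real \<Rightarrow> int \<Rightarrow> ((nat \<Rightarrow> complex) \<Rightarrow> (nat \<Rightarrow> complex)) set"
  where "band t k = {matrix_op t C | C. C \<in> fock_ops t \<and>
    (\<forall>m n. int m - int n \<noteq> k \<longrightarrow> fock_inner t (C (fock_basis t m)) (fock_basis t n) = 0)}"

definition band_operators :: "real \<Rightarrow> ((nat \<Rightarrow> complex) \<Rightarrow> (nat \<Rightarrow> complex)) set"
  where "band_operators t =
    {\<lambda>x n. \<Sum>k\<in>K. D k x n | K D. finite K \<and> (\<forall>k\<in>K. D k \<in> band t k)}"

definition BDO :: "real \<Rightarrow> ((nat \<Rightarrow> complex) \<Rightarrow> (nat \<Rightarrow> complex)) set"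
  where "BDO t = {B \<in> ell2_ops.
    \<forall>\<epsilon>>0. \<exists>D\<in>band_operators t. op_norm ell2 ell2_norm (\<lambda>x n. B x n - D x n) < \<epsilon>}"

end

(*
  Expanding an entire function f in the monomials of the basis e_n, rotation invariance of the Gaussian
  measure makes the monomials orthogonal on every disc, so the squared L2 norm of f is the sum of its
  squared coefficients. This identifies the Fock space with l2 and U_z with the diagonal operator z^n,
  so that conjugation by U_z multiplies the (n,m) matrix entry of an operator by z^(n-m).

  An operator on the k-th diagonal is thus only multiplied by z^(-k), and finite sums of such operators
  as well as their norm limits are rotation continuous. Conversely, if B is rotation continuous, its
  Fejer means (the averages of U_z B U_z* against the Fejer kernel) are band operators that converge to B
  in norm. On finitely supported vectors and finitely many coordinates this average is an exact finite
  sum over L-th roots of unity for large L, which replaces the operator-valued integral.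
*)

theory Submission
  imports Defs "HOL-Probability.Distributions"
begin

text \<open>Fejer weights are used because the kernel is nonnegative with average 1: the error of a
  mean is then an average of the errors \<open>twist \<zeta> B - B\<close>, small near 1 by
  continuity and at most twice the norm of B elsewhere, where the kernel is O(1/N). Plain symmetric
  partial sums of diagonals carry no such bound. Averaging commutes with taking matrix entries, so
  the mean is written down diagonal by diagonal, with the Fourier coefficients of the kernel as
  weights; the roots of unity serve only to compare it with B. Operators are total functions of
  which only the values on the carrier matter. Operators that agree on \<open>ell2\<close> can be
  different functions, while membership in \<open>band t k\<close> concerns the function itself. The
  analytic argument is therefore run with \<open>band_approximable\<close>, which speaks of norms on
  \<open>ell2\<close> only, and is tied to \<open>BDO\<close> at the end. Parseval is proved in
  [0, \<infinity>], first on discs, where the partial sums of a power series are bounded, then on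
  the plane by monotone convergence. The same identity thus decides which coefficient sequences
  belong to the Fock space.\<close>

section \<open>Square-summable sequences and their bounded operators\<close>

lemma ell2_norm_nonneg: "x \<in> ell2 \<Longrightarrow> ell2_norm x \<ge> 0"
  by (simp add: ell2_def ell2_norm_def suminf_nonneg)

text \<open>The partial sums of squares increase, so one bound for all finite sections gives
  summability and the norm estimate together. Norm inequalities on \<open>ell2\<close> are thereby
  reduced to those for the finite \<open>L2_set\<close>.\<close>

lemma ell2_normI:
  assumes "0 \<le> c" "\<And>S. L2_set (\<lambda>n. cmod (x n)) {..<S} \<le> c"
  shows "x \<in> ell2" "ell2_norm x \<le> c"
proof -
  have le: "(\<Sum>n<S. (cmod (x n))\<^sup>2) \<le> c\<^sup>2" for S
    using assms(2)[of S] unfolding L2_set_def by (rule sqrt_le_D)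
  then have s: "summable (\<lambda>n. (cmod (x n))\<^sup>2)"
    by (intro summableI_nonneg_bounded) auto
  then show "x \<in> ell2" by (simp add: ell2_def)
  have "(\<Sum>n. (cmod (x n))\<^sup>2) \<le> c\<^sup>2"
    by (rule suminf_le_const[OF s le])
  then show "ell2_norm x \<le> c"
    unfolding ell2_norm_def using assms(1) by (intro real_le_lsqrt) auto
qed

lemma L2_set_le_ell2_norm:
  assumes "x \<in> ell2" "finite S"
  shows "L2_set (\<lambda>n. cmod (x n)) S \<le> ell2_norm x"
  unfolding L2_set_def ell2_norm_def
  using assms by (intro real_sqrt_le_mono sum_le_suminf) (auto simp: ell2_def)

lemma cmod_le_ell2_norm: "x \<in> ell2 \<Longrightarrow> cmod (x n) \<le> ell2_norm x"
  using L2_set_le_ell2_norm[of x "{n}"] by simp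

lemma ell2_add:
  assumes "x \<in> ell2" "y \<in> ell2"
  shows "(\<lambda>n. x n + y n) \<in> ell2" "ell2_norm (\<lambda>n. x n + y n) \<le> ell2_norm x + ell2_norm y"
proof -
  have "L2_set (\<lambda>n. cmod (x n + y n)) {..<S} \<le> ell2_norm x + ell2_norm y" for S
  proof -
    have "L2_set (\<lambda>n. cmod (x n + y n)) {..<S} \<le> L2_set (\<lambda>n. cmod (x n) + cmod (y n)) {..<S}"
      by (intro L2_set_mono norm_triangle_ineq) auto
    also have "\<dots> \<le> L2_set (\<lambda>n. cmod (x n)) {..<S} + L2_set (\<lambda>n. cmod (y n)) {..<S}"
      by (rule L2_set_triangle_ineq)
    also have "\<dots> \<le> ell2_norm x + ell2_norm y"
      using assms by (intro add_mono L2_set_le_ell2_norm) auto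
    finally show ?thesis .
  qed
  then show "(\<lambda>n. x n + y n) \<in> ell2" "ell2_norm (\<lambda>n. x n + y n) \<le> ell2_norm x + ell2_norm y"
    using assms by (auto intro!: ell2_normI[of "ell2_norm x + ell2_norm y"] simp: ell2_norm_nonneg)
qed

lemma ell2_scale:
  assumes "x \<in> ell2"
  shows "(\<lambda>n. c * x n) \<in> ell2" "ell2_norm (\<lambda>n. c * x n) = cmod c * ell2_norm x"
proof -
  have "summable (\<lambda>n. (cmod (x n))\<^sup>2)" using assms by (simp add: ell2_def)
  then show "(\<lambda>n. c * x n) \<in> ell2" "ell2_norm (\<lambda>n. c * x n) = cmod c * ell2_norm x"
    by (simp_all add: ell2_def ell2_norm_def norm_mult power_mult_distrib summable_mult suminf_mult real_sqrt_mult)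
qed

lemma ell2_diff:
  assumes "x \<in> ell2" "y \<in> ell2"
  shows "(\<lambda>n. x n - y n) \<in> ell2" "ell2_norm (\<lambda>n. x n - y n) \<le> ell2_norm x + ell2_norm y"
  using ell2_add[OF assms(1) ell2_scale(1)[OF assms(2), of "-1"]] ell2_scale(2)[OF assms(2), of "-1"] by simp_all

lemma zero_in_ell2 [simp]: "(\<lambda>n. 0) \<in> ell2" and ell2_norm_zero [simp]: "ell2_norm (\<lambda>n. 0) = 0"
  by (simp_all add: ell2_def ell2_norm_def)

lemma ell2_sum:
  assumes "finite K" "\<And>k. k \<in> K \<Longrightarrow> X k \<in> ell2"
  shows "(\<lambda>n. \<Sum>k\<in>K. X k n) \<in> ell2 \<and> ell2_norm (\<lambda>n. \<Sum>k\<in>K. X k n) \<le> (\<Sum>k\<in>K. ell2_norm (X k))"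
  using assms
proof (induction K rule: finite_induct)
  case (insert k K)
  then show ?case
    using ell2_add[of "X k" "\<lambda>n. \<Sum>k\<in>K. X k n"] by simp
qed simp

lemma ell2_mono:
  assumes "x \<in> ell2" "\<And>n. cmod (y n) \<le> cmod (x n)"
  shows "y \<in> ell2" "ell2_norm y \<le> ell2_norm x"
proof -
  have "L2_set (\<lambda>n. cmod (y n)) {..<S} \<le> ell2_norm x" for S
    by (rule order_trans[OF L2_set_mono L2_set_le_ell2_norm[of x]]) (use assms in auto)
  then show "y \<in> ell2" "ell2_norm y \<le> ell2_norm x"
    using assms(1) by (auto intro!: ell2_normI[of "ell2_norm x"] simp: ell2_norm_nonneg)
qed

lemma ell2_unimodular:
  assumes "\<And>n. cmod (u n) = 1"
  shows "(\<lambda>n. u n * x n) \<in> ell2 \<longleftrightarrow> x \<in> ell2" "ell2_norm (\<lambda>n. u n * x n) = ell2_norm x"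
  using assms by (simp_all add: ell2_def ell2_norm_def norm_mult)

section \<open>Truncations and unit vectors\<close>

definition trunc :: "nat \<Rightarrow> (nat \<Rightarrow> complex) \<Rightarrow> nat \<Rightarrow> complex"
  where "trunc S x = (\<lambda>n. if n < S then x n else 0)"

lemma trunc_in_ell2: "trunc S x \<in> ell2"
proof -
  have "(\<lambda>n. (cmod (trunc S x n))\<^sup>2) = (\<lambda>n. if n \<in> {..<S} then (cmod (x n))\<^sup>2 else 0)"
    by (auto simp: trunc_def)
  then show ?thesis by (simp add: ell2_def del: lessThan_iff)
qed

lemma ell2_norm_trunc: "x \<in> ell2 \<Longrightarrow> ell2_norm (trunc S x) \<le> ell2_norm x"
  by (rule ell2_mono) (auto simp: trunc_def)

text \<open>The squared norm of the tail is the total sum minus a partial sum. Finitely supported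
  sequences are thus dense, which lets operators be handled through their matrix entries.\<close>

lemma trunc_LIMSEQ:
  assumes "x \<in> ell2"
  shows "(\<lambda>S. ell2_norm (\<lambda>n. x n - trunc S x n)) \<longlonglongrightarrow> 0"
proof -
  have s: "summable (\<lambda>n. (cmod (x n))\<^sup>2)" using assms by (simp add: ell2_def)
  have "ell2_norm (\<lambda>n. x n - trunc S x n) = sqrt ((\<Sum>n. (cmod (x n))\<^sup>2) - (\<Sum>n<S. (cmod (x n))\<^sup>2))" for S
  proof -
    have "(\<lambda>n. (cmod (x n - trunc S x n))\<^sup>2) = (\<lambda>n. if n \<in> {..<S} then 0 else (cmod (x n))\<^sup>2)"
      by (auto simp: trunc_def)
    moreover have "(\<lambda>n. if n \<in> {..<S} then 0 else (cmod (x n))\<^sup>2) sums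
       ((\<Sum>n. (cmod (x n))\<^sup>2) + (\<Sum>n<S. 0 - (cmod (x n))\<^sup>2))"
      by (rule sums_If_finite_set'[OF summable_sums[OF s]]) auto
    ultimately show ?thesis
      by (simp add: ell2_norm_def sums_unique[symmetric] sum_negf del: lessThan_iff)
  qed
  moreover have "(\<lambda>S. sqrt ((\<Sum>n. (cmod (x n))\<^sup>2) - (\<Sum>n<S. (cmod (x n))\<^sup>2))) \<longlonglongrightarrow> sqrt ((\<Sum>n. (cmod (x n))\<^sup>2) - (\<Sum>n. (cmod (x n))\<^sup>2))"
    using summable_LIMSEQ[OF s] by (intro tendsto_intros)
  ultimately show ?thesis by simp
qed

definition unit_seq :: "nat \<Rightarrow> nat \<Rightarrow> complex"
  where "unit_seq m = (\<lambda>n. if n = m then 1 else 0)"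

lemma unit_seq_in_ell2 [simp]: "unit_seq m \<in> ell2" and ell2_norm_unit_seq [simp]: "ell2_norm (unit_seq m) = 1"
proof -
  have "(\<lambda>n. (cmod (unit_seq m n))\<^sup>2) = (\<lambda>n. if n = m then 1 else 0)"
    by (auto simp: unit_seq_def)
  then show "unit_seq m \<in> ell2" "ell2_norm (unit_seq m) = 1"
    using sums_single[of m "\<lambda>_. 1::real"] by (simp_all add: ell2_def ell2_norm_def sums_iff)
qed

section \<open>Bounded operators, matrix entries and the operator norm\<close>

lemma bounded_opsE:
  assumes "B \<in> bounded_ops H N" "\<And>f. f \<in> H \<Longrightarrow> N f \<ge> 0"
  obtains K where "K \<ge> 0" "\<And>f. f \<in> H \<Longrightarrow> N (B f) \<le> K * N f"
proof -
  obtain K where K: "\<And>f. f \<in> H \<Longrightarrow> N (B f) \<le> K * N f"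
    using assms(1) unfolding bounded_ops_def by blast
  show ?thesis
  \<comment> \<open>The definition of \<open>bounded_ops\<close> puts no sign condition on the
    constant; the maximum with 0 is still a bound because N is nonnegative on H.\<close>
  proof (rule that[of "max K 0"])
    fix f assume f: "f \<in> H"
    have "N (B f) \<le> K * N f" by (rule K[OF f])
    also have "\<dots> \<le> max K 0 * N f" using assms(2)[OF f] by (intro mult_right_mono) auto
    finally show "N (B f) \<le> max K 0 * N f" .
  qed simp
qed

lemma bounded_opsD:
  assumes "B \<in> bounded_ops H N"
  shows "f \<in> H \<Longrightarrow> B f \<in> H"
    and "f \<in> H \<Longrightarrow> g \<in> H \<Longrightarrow> B (\<lambda>z. f z + g z) = (\<lambda>z. B f z + B g z)"
    and "f \<in> H \<Longrightarrow> B (\<lambda>z. c * f z) = (\<lambda>z. c * B f z)"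
  using assms by (auto simp: bounded_ops_def)

lemma ell2_ops_diff:
  assumes B: "B \<in> ell2_ops" and "x \<in> ell2" "y \<in> ell2"
  shows "B (\<lambda>n. x n - y n) = (\<lambda>n. B x n - B y n)"
  using bounded_opsD(2)[OF B assms(2) ell2_scale(1)[OF assms(3), of "-1"]] bounded_opsD(3)[OF B assms(3), of "-1"]
  by simp

lemma ell2_ops_trunc:
  assumes B: "B \<in> ell2_ops"
  shows "B (trunc S x) n = (\<Sum>m<S. B (unit_seq m) n * x m)"
proof (induction S)
  case 0
  \<comment> \<open>Homogeneity with factor 0 is what gives B 0 = 0, so the empty truncation is
    written as 0 times a unit vector.\<close>
  have "trunc 0 x = (\<lambda>n. 0 * unit_seq 0 n)" by (auto simp: trunc_def)
  then show ?case using bounded_opsD(3)[OF B, of "unit_seq 0" 0] by simp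
next
  case (Suc S)
  have "trunc (Suc S) x = (\<lambda>n. trunc S x n + x S * unit_seq S n)"
    by (auto simp: trunc_def unit_seq_def less_Suc_eq)
  then have "B (trunc (Suc S) x) = (\<lambda>n. B (trunc S x) n + x S * B (unit_seq S) n)"
    using bounded_opsD(2)[OF B trunc_in_ell2[of S x] ell2_scale(1)[of "unit_seq S" "x S"]] bounded_opsD(3)[OF B, of "unit_seq S" "x S"] by simp
  then show ?case using Suc by simp
qed

text \<open>A single coordinate is bounded by the norm, and B is Lipschitz, so convergence of the
  truncations carries over to each coordinate of the image.\<close>

lemma ell2_ops_trunc_LIMSEQ:
  assumes B: "B \<in> ell2_ops" and x: "x \<in> ell2"
  shows "(\<lambda>S. B (trunc S x) n) \<longlonglongrightarrow> B x n"
proof -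
  obtain K where K: "K \<ge> 0" "\<And>f. f \<in> ell2 \<Longrightarrow> ell2_norm (B f) \<le> K * ell2_norm f"
    using bounded_opsE[OF B ell2_norm_nonneg] by blast
  have "cmod (B (trunc S x) n - B x n) \<le> K * ell2_norm (\<lambda>n. x n - trunc S x n)" for S
  proof -
    have d: "(\<lambda>n. x n - trunc S x n) \<in> ell2" by (intro ell2_diff x trunc_in_ell2)
    have "cmod (B (trunc S x) n - B x n) = cmod (B (\<lambda>n. x n - trunc S x n) n)"
      by (simp add: ell2_ops_diff[OF B x trunc_in_ell2] norm_minus_commute)
    also have "\<dots> \<le> ell2_norm (B (\<lambda>n. x n - trunc S x n))"
      by (intro cmod_le_ell2_norm bounded_opsD(1)[OF B] d)
    also have "\<dots> \<le> K * ell2_norm (\<lambda>n. x n - trunc S x n)" by (rule K(2)[OF d])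
    finally show ?thesis .
  qed
  note le = this
  have "(\<lambda>S. K * ell2_norm (\<lambda>n. x n - trunc S x n)) \<longlonglongrightarrow> 0"
    using tendsto_mult_left[OF trunc_LIMSEQ[OF x], of K] by simp
  then have "(\<lambda>S. B (trunc S x) n - B x n) \<longlonglongrightarrow> 0"
    by (rule Lim_null_comparison[OF always_eventually, rotated]) (use le in simp)
  then show ?thesis by (simp add: LIM_zero_cancel)
qed

text \<open>The finite formula for truncations passes to the limit, so a bounded operator is
  determined on \<open>ell2\<close> by its matrix entries, column m being the image of
  \<open>unit_seq m\<close>.\<close>

lemma ell2_ops_matrix_sums:
  assumes "B \<in> ell2_ops" "x \<in> ell2"
  shows "(\<lambda>m. B (unit_seq m) n * x m) sums B x n"
  using ell2_ops_trunc_LIMSEQ[OF assms] by (simp add: sums_def ell2_ops_trunc[OF assms(1)])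

text \<open>The element \<open>f0\<close> makes the set under the supremum nonempty; the supremum of
  an empty set of reals would carry no information.\<close>

lemma op_norm_le:
  assumes "0 \<le> K" "f0 \<in> H" "N f0 \<le> 1" "\<And>f. f \<in> H \<Longrightarrow> N f \<le> 1 \<Longrightarrow> N (A f) \<le> K"
  shows "op_norm H N A \<le> K"
  unfolding op_norm_def using assms by (intro cSUP_least) auto

lemma ell2_op_norm_bound:
  assumes K: "\<And>x. x \<in> ell2 \<Longrightarrow> ell2_norm (B x) \<le> K * ell2_norm x"
    and hom: "\<And>c x. x \<in> ell2 \<Longrightarrow> B (\<lambda>n. c * x n) = (\<lambda>n. c * B x n)"
    and B: "\<And>x. x \<in> ell2 \<Longrightarrow> B x \<in> ell2"
    and x: "x \<in> ell2"
  shows "ell2_norm (B x) \<le> op_norm ell2 ell2_norm B * ell2_norm x" and "0 \<le> op_norm ell2 ell2_norm B"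
proof -
  have "K \<ge> 0" using K[of "unit_seq 0"] ell2_norm_nonneg[OF B, of "unit_seq 0"] by simp
  \<comment> \<open>The supremum of a set of reals is only informative once the set is bounded
    above, hence the bound K among the hypotheses.\<close>
  have "bdd_above ((\<lambda>f. ell2_norm (B f)) ` {f \<in> ell2. ell2_norm f \<le> 1})"
  proof (rule bdd_aboveI2)
    fix f assume f: "f \<in> {f \<in> ell2. ell2_norm f \<le> 1}"
    then have "ell2_norm (B f) \<le> K * ell2_norm f" by (intro K) auto
    also have "\<dots> \<le> K * 1" using f \<open>K \<ge> 0\<close> by (intro mult_left_mono) auto
    finally show "ell2_norm (B f) \<le> K" by simp
  qed
  then have up: "ell2_norm (B f) \<le> op_norm ell2 ell2_norm B" if "f \<in> ell2" "ell2_norm f \<le> 1" for f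
    unfolding op_norm_def using that by (intro cSUP_upper) auto
  show "0 \<le> op_norm ell2 ell2_norm B"
    using up[of "unit_seq 0"] ell2_norm_nonneg[OF B, of "unit_seq 0"] by simp
  show "ell2_norm (B x) \<le> op_norm ell2 ell2_norm B * ell2_norm x"
  \<comment> \<open>Scaling to norm 1 fails for norm 0; there the crude bound K already forces the
    image to have norm 0.\<close>
  proof (cases "ell2_norm x = 0")
    case True
    then show ?thesis using K[OF x] ell2_norm_nonneg[OF B[OF x]] by simp
  next
    case False
    then have pos: "ell2_norm x > 0" using ell2_norm_nonneg[OF x] by linarith
    let ?c = "complex_of_real (1 / ell2_norm x)"
    have "ell2_norm (B (\<lambda>n. ?c * x n)) \<le> op_norm ell2 ell2_norm B"
      using pos by (intro up) (simp_all only: ell2_scale[OF x] norm_of_real, simp_all)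
    moreover have "ell2_norm (B (\<lambda>n. ?c * x n)) = ell2_norm (B x) / ell2_norm x"
      using pos by (simp only: hom[OF x] ell2_scale[OF B[OF x]] norm_of_real) simp
    ultimately have "ell2_norm (B x) / ell2_norm x \<le> op_norm ell2 ell2_norm B" by simp
    then show ?thesis using pos by (simp add: pos_divide_le_eq)
  qed
qed

section \<open>Lebesgue measure on the complex plane\<close>

lemma Complex_measurable [measurable (raw)]:
  assumes "f \<in> borel_measurable M" "g \<in> borel_measurable M"
  shows "(\<lambda>x. Complex (f x) (g x)) \<in> borel_measurable M"
  using assms by (simp add: borel_measurable_complex_iff)

text \<open>Lebesgue measure is characterised by its values on open boxes, and the preimage of a box
  is a product of two intervals.\<close>

lemma lborel_complex_eq_distr:
  "(lborel :: complex measure) = distr (lborel \<Otimes>\<^sub>M lborel) borel (\<lambda>(x, y). Complex x y)"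
proof (rule lborel_eqI)
  have [measurable]: "(\<lambda>(x, y). Complex x y) \<in> borel_measurable (lborel \<Otimes>\<^sub>M lborel)"
    by (simp add: split_def)
  fix l u :: complex
  assume le: "\<And>b. b \<in> Basis \<Longrightarrow> l \<bullet> b \<le> u \<bullet> b"
  then have le1: "Re l \<le> Re u" and le2: "Im l \<le> Im u"
    using le[of 1] le[of \<i>] by (auto simp: Basis_complex_def)
  have vim: "(\<lambda>(x, y). Complex x y) -` box l u \<inter> space (lborel \<Otimes>\<^sub>M lborel) = {Re l <..< Re u} \<times> {Im l <..< Im u}"
    by (auto simp: box_def Basis_complex_def space_pair_measure)
  have "emeasure (distr (lborel \<Otimes>\<^sub>M lborel) borel (\<lambda>(x, y). Complex x y)) (box l u)
     = emeasure (lborel \<Otimes>\<^sub>M lborel) ({Re l <..< Re u} \<times> {Im l <..< Im u})"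
    by (subst emeasure_distr) (simp_all only: vim, simp_all)
  also have "\<dots> = ennreal (Re u - Re l) * ennreal (Im u - Im l)"
    using le1 le2 by (subst lborel.emeasure_pair_measure_Times) simp_all
  also have "\<dots> = (\<Prod>b\<in>Basis. (u - l) \<bullet> b)"
    using le1 le2 by (simp add: Basis_complex_def ennreal_mult)
  finally show "emeasure (distr (lborel \<Otimes>\<^sub>M lborel) borel (\<lambda>(x, y). Complex x y)) (box l u) = ennreal (\<Prod>b\<in>Basis. (u - l) \<bullet> b)" .
qed simp

text \<open>Tonelli in both orders: a horizontal shear is removed by integrating over the real part
  first, a vertical one by integrating over the imaginary part first.\<close>

lemma nn_integral_lborel_complex:
  assumes [measurable]: "f \<in> borel_measurable borel"
  shows "(\<integral>\<^sup>+z. f z \<partial>lborel) = (\<integral>\<^sup>+x. \<integral>\<^sup>+y. f (Complex x y) \<partial>lborel \<partial>lborel)"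
    and "(\<integral>\<^sup>+z. f z \<partial>lborel) = (\<integral>\<^sup>+y. \<integral>\<^sup>+x. f (Complex x y) \<partial>lborel \<partial>lborel)"
proof -
  have m[measurable]: "(\<lambda>(x, y). Complex x y) \<in> borel_measurable (lborel \<Otimes>\<^sub>M lborel)"
    by (simp add: split_def)
  have eq: "(\<integral>\<^sup>+z. f z \<partial>lborel) = (\<integral>\<^sup>+(x, y). f (Complex x y) \<partial>(lborel \<Otimes>\<^sub>M lborel))"
    by (subst lborel_complex_eq_distr, subst nn_integral_distr) (auto simp: split_def)
  have fm: "(\<lambda>(x, y). f (Complex x y)) \<in> borel_measurable (lborel \<Otimes>\<^sub>M lborel)"
    using measurable_compose[OF m assms] by (simp add: split_def)
  show "(\<integral>\<^sup>+z. f z \<partial>lborel) = (\<integral>\<^sup>+x. \<integral>\<^sup>+y. f (Complex x y) \<partial>lborel \<partial>lborel)"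
    unfolding eq using lborel.nn_integral_fst[OF fm] by simp
  show "(\<integral>\<^sup>+z. f z \<partial>lborel) = (\<integral>\<^sup>+y. \<integral>\<^sup>+x. f (Complex x y) \<partial>lborel \<partial>lborel)"
    unfolding eq using lborel_pair.nn_integral_snd[OF fm] by simp
qed

lemma nn_integral_lborel_translate:
  fixes c :: real
  assumes "f \<in> borel_measurable borel"
  shows "(\<integral>\<^sup>+x. f (x + c) \<partial>lborel) = (\<integral>\<^sup>+x. f x \<partial>lborel)"
  using assms by (subst (2) lborel_distr_plus[of c, symmetric], subst nn_integral_distr) (auto simp: add.commute)

text \<open>For fixed imaginary part the shear is a translation of the real line, and Lebesgue
  measure on the line is translation invariant.\<close>

lemma nn_integral_shear_x:
  assumes [measurable]: "f \<in> borel_measurable borel"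
  shows "(\<integral>\<^sup>+z. f (Complex (Re z + a * Im z) (Im z)) \<partial>lborel) = (\<integral>\<^sup>+z. f z \<partial>lborel)"
  by (simp add: nn_integral_lborel_complex(2) nn_integral_lborel_translate[of "\<lambda>x. f (Complex x _)"])

lemma nn_integral_shear_y:
  assumes [measurable]: "f \<in> borel_measurable borel"
  shows "(\<integral>\<^sup>+z. f (Complex (Re z) (Im z + a * Re z)) \<partial>lborel) = (\<integral>\<^sup>+z. f z \<partial>lborel)"
  by (simp add: nn_integral_lborel_complex(1) nn_integral_lborel_translate[of "\<lambda>x. f (Complex _ x)"])

text \<open>A rotation that is not \<open>\<plusminus>1\<close> is a product of three shears.\<close>

lemma lborel_distr_rotation:
  fixes \<zeta> :: complex
  assumes "cmod \<zeta> = 1" "Im \<zeta> \<noteq> 0"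
  shows "distr lborel borel ((*) \<zeta>) = lborel"
proof (rule measure_eqI)
  fix X assume "X \<in> sets (distr lborel borel ((*) \<zeta>))"
  then have X[measurable]: "X \<in> sets borel" by simp
  \<comment> \<open>For \<zeta> = cis \<theta> this is - tan (\<theta> / 2), the factor of the two
    outer horizontal shears; the middle vertical shear has factor sin \<theta>.\<close>
  let ?a = "(Re \<zeta> - 1) / Im \<zeta>"
  have sq: "Re \<zeta> * Re \<zeta> + Im \<zeta> * Im \<zeta> = 1"
    using assms(1) cmod_power2[of \<zeta>] by (simp add: power2_eq_square)
  have s: "Complex (Re z + ?a * Im z + ?a * (Im z + Im \<zeta> * (Re z + ?a * Im z))) (Im z + Im \<zeta> * (Re z + ?a * Im z))
      = \<zeta> * z" (is "?L = _") for z
  proof -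
    have i: "Im \<zeta> * ?a = Re \<zeta> - 1" using assms(2) by simp
    have "Im ?L = Im z + Im \<zeta> * Re z + (Im \<zeta> * ?a) * Im z" by (simp add: algebra_simps)
    also have "\<dots> = Im (\<zeta> * z)" unfolding i by (simp add: algebra_simps)
    finally have 1: "Im ?L = Im (\<zeta> * z)" .
    \<comment> \<open>This is where |\<zeta>| = 1 enters: (Re \<zeta> - 1) (Re \<zeta> + 1) is minus
      the square of Im \<zeta>.\<close>
    have j: "?a * (Re \<zeta> + 1) = - Im \<zeta>"
      using assms(2) sq by (simp add: field_simps)
    have "Re ?L = Re z + (Im \<zeta> * ?a) * Re z + (?a * (1 + (Im \<zeta> * ?a) + 1)) * Im z"
      by (simp add: algebra_simps)
    also have "\<dots> = Re \<zeta> * Re z + (?a * (Re \<zeta> + 1)) * Im z" unfolding i by (simp add: algebra_simps)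
    also have "\<dots> = Re (\<zeta> * z)" unfolding j by simp
    finally show ?thesis using 1 by (simp add: complex_eq_iff)
  qed
  let ?f = "indicator X :: complex \<Rightarrow> ennreal"
  have "emeasure (distr lborel borel ((*) \<zeta>)) X = (\<integral>\<^sup>+z. ?f (\<zeta> * z) \<partial>lborel)"
    by (subst nn_integral_indicator[symmetric], simp, subst nn_integral_distr) auto
  also have "\<dots> = (\<integral>\<^sup>+z. ?f z \<partial>lborel)"
    using nn_integral_shear_x[of ?f ?a]
      nn_integral_shear_y[of "\<lambda>z. ?f (Complex (Re z + ?a * Im z) (Im z))" "Im \<zeta>"]
      nn_integral_shear_x[of "\<lambda>z. ?f (Complex (Re z + ?a * (Im z + Im \<zeta> * Re z)) (Im z + Im \<zeta> * Re z))" ?a]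
    by (simp only: complex.sel s) simp
  also have "\<dots> = emeasure lborel X" by simp
  finally show "emeasure (distr lborel borel ((*) \<zeta>)) X = emeasure lborel X" .
qed simp

text \<open>The disc of squared radius r has area pi times r, and half-lines generate the Borel sets
  and are closed under intersection. This plays the part of polar coordinates for functions of the
  modulus.\<close>

lemma distr_cmod_square:
  "distr lborel borel (\<lambda>z::complex. (cmod z)\<^sup>2) = density lborel (\<lambda>s::real. ennreal pi * indicator {0..} s)"
proof (rule measure_eqI_generator_eq[where E = "range atMost" and \<Omega> = UNIV and A = "\<lambda>n. {..real n}"])
  have 1: "emeasure (distr lborel borel (\<lambda>z::complex. (cmod z)\<^sup>2)) {..r} = ennreal (pi * max r 0)" for r :: real
  proof (cases "r \<ge> 0")
    case True
    have "(\<lambda>z::complex. (cmod z)\<^sup>2) -` {..r} \<inter> space lborel = cball 0 (sqrt r)"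
      using True by (auto simp: real_le_rsqrt sqrt_ge_absD)
    then show ?thesis
      using True by (simp add: emeasure_distr emeasure_cball unit_ball_vol_2)
  next
    case False
    then have "(\<lambda>z::complex. (cmod z)\<^sup>2) -` {..r} \<inter> space lborel = {}"
      by (auto simp: not_le) (meson less_le_trans not_less zero_le_power2)
    with False show ?thesis by (simp add: emeasure_distr)
  qed
  have 2: "emeasure (density lborel (\<lambda>s::real. ennreal pi * indicator {0..} s)) {..r} = ennreal (pi * max r 0)" for r :: real
  proof -
    have "emeasure (density lborel (\<lambda>s::real. ennreal pi * indicator {0..} s)) {..r}
        = (\<integral>\<^sup>+s. ennreal pi * indicator {0..r} s \<partial>lborel)"
      by (subst emeasure_density) (auto intro!: nn_integral_cong split: split_indicator)
    also have "\<dots> = ennreal (pi * max r 0)"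
      by (subst nn_integral_cmult) (cases "r \<ge> 0"; auto simp: ennreal_mult max_def)+
    finally show ?thesis .
  qed
  fix X :: "real set" assume "X \<in> range atMost"
  then show "emeasure (distr lborel borel (\<lambda>z::complex. (cmod z)\<^sup>2)) X = emeasure (density lborel (\<lambda>s::real. ennreal pi * indicator {0..} s)) X"
    using 1 2 by auto
next
  show "Int_stable (range atMost :: real set set)"
    by (auto simp: Int_stable_def)
  show "(\<Union>i. {..real i}) = UNIV"
    using real_arch_simple by auto
  show "sets (distr lborel borel (\<lambda>z::complex. (cmod z)\<^sup>2)) = sigma_sets UNIV (range atMost)"
    by (simp add: borel_eq_atMost)
  show "sets (density lborel (\<lambda>s::real. ennreal pi * indicator {0..} s)) = sigma_sets UNIV (range atMost)"
    by (simp add: borel_eq_atMost)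
  fix n
  have "emeasure (distr lborel borel (\<lambda>z::complex. (cmod z)\<^sup>2)) {..real n} \<le> emeasure lborel (cball (0::complex) (sqrt (real n)))"
    by (subst emeasure_distr) (auto intro!: emeasure_mono real_le_rsqrt)
  also have "\<dots> < \<infinity>" by (simp add: emeasure_cball)
  finally show "emeasure (distr lborel borel (\<lambda>z::complex. (cmod z)\<^sup>2)) {..real n} \<noteq> \<infinity>" by simp
qed auto

text \<open>With s for the squared modulus the integral becomes one over the half-line, and scaling
  s by t turns it into the Gamma integral n!. This explains the normalisation of
  \<open>fock_basis\<close>, and n = 0 gives total mass 1.\<close>

lemma nn_integral_gauss_moment:
  assumes "t > 0"
  shows "(\<integral>\<^sup>+z. ennreal ((cmod z) ^ (2 * n)) \<partial>gauss_measure t) = ennreal (fact n * t ^ n)"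
proof -
  let ?g = "\<lambda>s. ennreal (s ^ n) * ennreal (1 / (pi * t) * exp (- s / t))"
  have "(\<integral>\<^sup>+z. ennreal ((cmod z) ^ (2 * n)) \<partial>gauss_measure t) = (\<integral>\<^sup>+z. ?g ((cmod z)\<^sup>2) \<partial>lborel)"
    unfolding gauss_measure_def by (subst nn_integral_density) (auto simp: power_mult[of _ 2 n, symmetric] mult.commute)
  also have "\<dots> = (\<integral>\<^sup>+s. ?g s \<partial>distr lborel borel (\<lambda>z::complex. (cmod z)\<^sup>2))"
    by (subst nn_integral_distr) auto
  also have "\<dots> = (\<integral>\<^sup>+s. ennreal pi * indicator {0..} s * ?g s \<partial>lborel)"
    unfolding distr_cmod_square by (subst nn_integral_density) auto
  also have "\<dots> = ennreal t * (\<integral>\<^sup>+s. ennreal pi * indicator {0..} (t * s) * ?g (t * s) \<partial>lborel)"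
    using assms nn_integral_real_affine[of "\<lambda>s. ennreal pi * indicator {0..} s * ?g s" t 0] by simp
  also have "(\<integral>\<^sup>+s. ennreal pi * indicator {0..} (t * s) * ?g (t * s) \<partial>lborel)
     = (\<integral>\<^sup>+s. ennreal (t ^ n / t) * (ennreal (s ^ n * exp (- s)) * indicator {0..} s) \<partial>lborel)"
    using assms by (intro nn_integral_cong)
      (auto simp: zero_le_mult_iff field_simps power_mult_distrib ennreal_mult[symmetric] split: split_indicator)
  also have "\<dots> = ennreal (t ^ n / t) * ennreal (fact n)"
    by (subst nn_integral_cmult) (auto simp: nn_intergal_power_times_exp_Ici)
  also have "ennreal t * \<dots> = ennreal (fact n * t ^ n)"
    using assms by (simp add: ennreal_mult[symmetric] mult.commute)
  finally show ?thesis .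
qed

section \<open>Rotation invariance of the Gaussian measure, orthogonality and Parseval\<close>

lemma space_gauss_measure [simp]: "space (gauss_measure t) = UNIV"
  and sets_gauss_measure [simp, measurable_cong]: "sets (gauss_measure t) = sets borel"
  by (simp_all add: gauss_measure_def)

lemma prob_space_gauss_measure: "t > 0 \<Longrightarrow> prob_space (gauss_measure t)"
  using nn_integral_gauss_moment[of t 0] by (intro prob_spaceI) simp

text \<open>The Gaussian density depends on the modulus only, so the invariance is inherited from
  Lebesgue measure.\<close>

lemma distr_gauss_rotation:
  assumes "cmod \<zeta> = 1" "Im \<zeta> \<noteq> 0"
  shows "distr (gauss_measure t) (gauss_measure t) ((*) \<zeta>) = gauss_measure t"
proof (rule measure_eqI)
  fix X assume "X \<in> sets (distr (gauss_measure t) (gauss_measure t) ((*) \<zeta>))"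
  then have X[measurable]: "X \<in> sets borel" by simp
  let ?w = "\<lambda>z::complex. ennreal (1 / (pi * t) * exp (- (cmod z)\<^sup>2 / t))"
  have "emeasure (distr (gauss_measure t) (gauss_measure t) ((*) \<zeta>)) X = (\<integral>\<^sup>+z. indicator X (\<zeta> * z) \<partial>gauss_measure t)"
    by (subst nn_integral_indicator[symmetric], simp, subst nn_integral_distr) auto
  also have "\<dots> = (\<integral>\<^sup>+z. ?w (\<zeta> * z) * indicator X (\<zeta> * z) \<partial>lborel)"
    unfolding gauss_measure_def using assms by (subst nn_integral_density) (auto simp: norm_mult)
  also have "\<dots> = (\<integral>\<^sup>+z. ?w z * indicator X z \<partial>distr lborel borel ((*) \<zeta>))"
    by (subst nn_integral_distr) auto
  also have "\<dots> = emeasure (gauss_measure t) X"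
    unfolding lborel_distr_rotation[OF assms] gauss_measure_def by (subst emeasure_density) auto
  finally show "emeasure (distr (gauss_measure t) (gauss_measure t) ((*) \<zeta>)) X = emeasure (gauss_measure t) X" .
qed simp

lemma cball_measurable [measurable]: "cball (z::complex) R \<in> sets borel"
  by simp

lemma integrable_cball_gauss:
  fixes g :: "complex \<Rightarrow> 'a::{banach, second_countable_topology}"
  assumes "t > 0" "continuous_on UNIV g"
  shows "integrable (gauss_measure t) (\<lambda>z. indicator (cball 0 R) z *\<^sub>R g z)"
proof -
  interpret prob_space "gauss_measure t" by (rule prob_space_gauss_measure) fact
  have "compact (g ` cball 0 R)"
    using assms(2) by (intro compact_continuous_image) (auto intro: continuous_on_subset)
  then obtain B where B: "\<And>z. z \<in> cball 0 R \<Longrightarrow> norm (g z) \<le> B"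
    by (metis compact_imp_bounded bounded_iff imageI)
  have [measurable]: "g \<in> borel_measurable borel"
    using assms(2) by (rule borel_measurable_continuous_onI)
  have "norm (indicator (cball 0 R) z *\<^sub>R g z) \<le> max B 0" for z
    using B[of z] by (auto split: split_indicator)
  then show ?thesis by (intro integrable_const_bound[of _ "max B 0"]) simp_all
qed

text \<open>A rotation preserves the disc and the measure but multiplies the integrand by a
  constant; a rotation whose constant differs from 1 forces the integral to vanish.\<close>

lemma integral_monomials_cball_orthogonal:
  assumes "m \<noteq> n"
  shows "(LINT z|gauss_measure t. indicator (cball 0 R) z *\<^sub>R (z ^ m * cnj z ^ n)) = 0"
proof -
  define d where "d = real_of_int \<bar>int m - int n\<bar>"
  have d: "d \<ge> 1" using assms by (simp add: d_def)
  \<comment> \<open>The angle is chosen so that m - n times it is pi/2 or - pi/2, which makes the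
    factor \<i> or - \<i>. It lies strictly between 0 and pi, so \<zeta> is not real, as
    \<open>distr_gauss_rotation\<close> demands.\<close>
  define \<zeta> where "\<zeta> = cis (pi / (2 * d))"
  have "0 < pi / (2 * d)" "pi / (2 * d) < pi" using d by (auto simp: field_simps)
  then have "sin (pi / (2 * d)) > 0" by (rule sin_gt_zero)
  then have \<zeta>: "cmod \<zeta> = 1" "Im \<zeta> \<noteq> 0" by (simp_all add: \<zeta>_def)
  have z: "\<zeta> ^ m * cnj \<zeta> ^ n = cis (pi / 2 * ((real m - real n) / d))"
  proof -
    have "\<zeta> ^ m * cnj \<zeta> ^ n = cis (real m * (pi / (2 * d)) + real n * - (pi / (2 * d)))"
      unfolding \<zeta>_def cis_cnj Complex.DeMoivre cis_mult ..
    also have "real m * (pi / (2 * d)) + real n * - (pi / (2 * d)) = pi / 2 * ((real m - real n) / d)"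
      by (simp add: diff_divide_distrib right_diff_distrib mult.commute)
    finally show ?thesis .
  qed
  have "(real m - real n) / d = 1 \<or> (real m - real n) / d = -1"
    using d assms by (cases "m < n") (auto simp: d_def field_simps)
  then have ne: "\<zeta> ^ m * cnj \<zeta> ^ n \<noteq> 1"
  proof
    assume r: "(real m - real n) / d = 1"
    show ?thesis unfolding z r by (simp add: complex_eq_iff)
  next
    assume r: "(real m - real n) / d = -1"
    show ?thesis unfolding z r by (simp add: complex_eq_iff)
  qed
  let ?g = "\<lambda>z::complex. indicator (cball 0 R) z *\<^sub>R (z ^ m * cnj z ^ n)"
  let ?J = "LINT z|gauss_measure t. ?g z"
  have [measurable]: "(\<lambda>z::complex. z ^ m * cnj z ^ n) \<in> borel_measurable borel"
    by (intro borel_measurable_continuous_onI continuous_intros)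
  have "?J = (LINT z|distr (gauss_measure t) (gauss_measure t) ((*) \<zeta>). ?g z)"
    by (simp add: distr_gauss_rotation[OF \<zeta>])
  also have "\<dots> = (LINT z|gauss_measure t. ?g (\<zeta> * z))"
    by (subst integral_distr) auto
  also have "\<dots> = (LINT z|gauss_measure t. (\<zeta> ^ m * cnj \<zeta> ^ n) * ?g z)"
    using \<zeta> by (intro Bochner_Integration.integral_cong)
      (auto simp: norm_mult power_mult_distrib split: split_indicator)
  also have "\<dots> = (\<zeta> ^ m * cnj \<zeta> ^ n) * ?J"
    by (rule integral_mult_right_zero)
  finally have "(\<zeta> ^ m * cnj \<zeta> ^ n - 1) * ?J = 0" by (simp add: algebra_simps)
  with ne show ?thesis by simp
qed

lemma entire_power_series:
  fixes f :: "complex \<Rightarrow> complex"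
  assumes "\<And>z. (\<lambda>n. a n * z ^ n) sums f z"
  shows "f holomorphic_on UNIV"
proof -
  have "f holomorphic_on ball 0 r" for r
    using assms by (intro power_series_holomorphic[of 0 r a]) auto
  then have "f holomorphic_on (\<Union>n. ball 0 (real n))"
    by (intro holomorphic_on_UN_open) auto
  also have "(\<Union>n. ball 0 (real n)) = (UNIV :: complex set)"
    using reals_Archimedean2 by auto
  finally show ?thesis .
qed

text \<open>For partial sums the mixed terms vanish by orthogonality; dominated convergence then
  passes to f, since all partial sums are bounded on the disc by one constant and the measure is
  finite.\<close>

lemma parseval_cball:
  assumes t: "t > 0" and sums: "\<And>z. (\<lambda>n. a n * z ^ n) sums f z"
  shows "(\<integral>\<^sup>+z. indicator (cball 0 R) z * ennreal ((cmod (f z))\<^sup>2) \<partial>gauss_measure t)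
    = (\<Sum>n. \<integral>\<^sup>+z. indicator (cball 0 R) z * ennreal ((cmod (a n * z ^ n))\<^sup>2) \<partial>gauss_measure t)"
proof -
  let ?I = "\<lambda>z::complex. indicator (cball 0 R) z :: real"
  interpret prob_space "gauss_measure t" by (rule prob_space_gauss_measure) fact
  have f: "continuous_on UNIV f"
    using entire_power_series[OF sums] by (rule holomorphic_on_imp_continuous_on)
  then have [measurable]: "f \<in> borel_measurable borel"
    by (rule borel_measurable_continuous_onI)
  define p where "p N z = (\<Sum>n<N. a n * z ^ n)" for N z
  have p: "continuous_on UNIV (p N)" for N
    unfolding p_def by (intro continuous_intros)
  then have [measurable]: "p N \<in> borel_measurable borel" for N
    by (rule borel_measurable_continuous_onI)
  \<comment> \<open>Convergence at |R| + 1 gives absolute convergence at |R|; the absolute value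
    takes care of negative R.\<close>
  have sn: "summable (\<lambda>n. cmod (a n * of_real \<bar>R\<bar> ^ n))"
    using sums_summable[OF sums[of "of_real (\<bar>R\<bar> + 1)"]] by (rule powser_insidea) auto
  define B where "B = (\<Sum>n. cmod (a n * of_real \<bar>R\<bar> ^ n))"
  have pB: "cmod (p N z) \<le> B" if "z \<in> cball 0 R" for N z
  proof -
    have "cmod (p N z) \<le> (\<Sum>n<N. cmod (a n * z ^ n))"
      unfolding p_def by (rule norm_sum)
    also have "\<dots> \<le> (\<Sum>n<N. cmod (a n * of_real \<bar>R\<bar> ^ n))"
      using that by (intro sum_mono) (auto simp: norm_mult norm_power intro!: mult_left_mono power_mono)
    also have "\<dots> \<le> B" unfolding B_def by (intro sum_le_suminf sn) auto
    finally show ?thesis .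
  qed
  have int: "(LINT z|gauss_measure t. ?I z * (cmod (p N z))\<^sup>2) = (\<Sum>n<N. LINT z|gauss_measure t. ?I z * (cmod (a n * z ^ n))\<^sup>2)" for N
  proof -
    \<comment> \<open>The squared modulus factors as p times its conjugate only over the complex
      numbers, so the identity is computed there and read back for the reals.\<close>
    have "complex_of_real (LINT z|gauss_measure t. ?I z * (cmod (p N z))\<^sup>2)
        = (LINT z|gauss_measure t. ?I z *\<^sub>R (p N z * cnj (p N z)))"
      by (subst integral_complex_of_real[symmetric]) (simp only: complex_norm_square of_real_mult scaleR_conv_of_real)
    also have "\<dots> = (LINT z|gauss_measure t. (\<Sum>m<N. \<Sum>n<N. (a m * cnj (a n)) * (?I z *\<^sub>R (z ^ m * cnj z ^ n))))"
    proof (rule Bochner_Integration.integral_cong[OF refl])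
      fix z
      have "p N z * cnj (p N z) = (\<Sum>m<N. \<Sum>n<N. (a m * cnj (a n)) * (z ^ m * cnj z ^ n))"
        by (simp add: p_def sum_product mult_ac)
      then show "?I z *\<^sub>R (p N z * cnj (p N z)) = (\<Sum>m<N. \<Sum>n<N. (a m * cnj (a n)) * (?I z *\<^sub>R (z ^ m * cnj z ^ n)))"
        by (simp add: scaleR_sum_right)
    qed
    also have "\<dots> = (\<Sum>m<N. \<Sum>n<N. (a m * cnj (a n)) * (LINT z|gauss_measure t. ?I z *\<^sub>R (z ^ m * cnj z ^ n)))"
    proof -
      have i: "integrable (gauss_measure t) (\<lambda>z. (a m * cnj (a n)) * (?I z *\<^sub>R (z ^ m * cnj z ^ n)))" for m n
        by (intro integrable_mult_right integrable_cball_gauss t) (auto intro!: continuous_intros)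
      show ?thesis
        by (subst Bochner_Integration.integral_sum, intro Bochner_Integration.integrable_sum i, rule sum.cong[OF refl],
            subst Bochner_Integration.integral_sum, rule i, rule sum.cong[OF refl], rule integral_mult_right_zero)
    qed
    also have "\<dots> = (\<Sum>m<N. (a m * cnj (a m)) * (LINT z|gauss_measure t. ?I z *\<^sub>R (z ^ m * cnj z ^ m)))"
    proof (rule sum.cong[OF refl])
      fix m assume "m \<in> {..<N}"
      then show "(\<Sum>n<N. (a m * cnj (a n)) * (LINT z|gauss_measure t. ?I z *\<^sub>R (z ^ m * cnj z ^ n)))
          = (a m * cnj (a m)) * (LINT z|gauss_measure t. ?I z *\<^sub>R (z ^ m * cnj z ^ m))"
        by (subst sum.remove[of _ m]) (auto intro!: sum.neutral simp: integral_monomials_cball_orthogonal)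
    qed
    also have "\<dots> = (\<Sum>m<N. LINT z|gauss_measure t. complex_of_real (?I z * (cmod (a m * z ^ m))\<^sup>2))"
      by (intro sum.cong refl, subst integral_mult_right_zero[symmetric], intro Bochner_Integration.integral_cong refl)
        (simp only: of_real_mult complex_norm_square scaleR_conv_of_real, simp add: algebra_simps)
    finally show ?thesis
      by (simp only: integral_complex_of_real of_real_sum[symmetric] of_real_eq_iff)
  qed
  have "(\<lambda>N. LINT z|gauss_measure t. ?I z * (cmod (p N z))\<^sup>2) \<longlonglongrightarrow> (LINT z|gauss_measure t. ?I z * (cmod (f z))\<^sup>2)"
  proof (rule integral_dominated_convergence[where w = "\<lambda>z. B\<^sup>2"])
    show "AE z in gauss_measure t. (\<lambda>N. ?I z * (cmod (p N z))\<^sup>2) \<longlonglongrightarrow> ?I z * (cmod (f z))\<^sup>2"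
      using sums unfolding sums_def p_def by (auto intro!: tendsto_intros)
    show "AE z in gauss_measure t. norm (?I z * (cmod (p N z))\<^sup>2) \<le> B\<^sup>2" for N
      using pB by (auto intro!: power_mono split: split_indicator)
  qed auto
  then have S: "(\<lambda>n. LINT z|gauss_measure t. ?I z * (cmod (a n * z ^ n))\<^sup>2) sums (LINT z|gauss_measure t. ?I z * (cmod (f z))\<^sup>2)"
    unfolding sums_def int .
  have nn: "(\<integral>\<^sup>+z. indicator (cball 0 R) z * ennreal ((cmod (g z))\<^sup>2) \<partial>gauss_measure t)
      = ennreal (LINT z|gauss_measure t. ?I z * (cmod (g z))\<^sup>2)" if "continuous_on UNIV g" for g :: "complex \<Rightarrow> complex"
  proof -
    have "(\<integral>\<^sup>+z. indicator (cball 0 R) z * ennreal ((cmod (g z))\<^sup>2) \<partial>gauss_measure t)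
       = (\<integral>\<^sup>+z. ennreal (?I z * (cmod (g z))\<^sup>2) \<partial>gauss_measure t)"
      by (intro nn_integral_cong) (auto split: split_indicator)
    also have "\<dots> = ennreal (LINT z|gauss_measure t. ?I z * (cmod (g z))\<^sup>2)"
      using integrable_cball_gauss[OF t, of "\<lambda>z. (cmod (g z))\<^sup>2" R] that
      by (intro nn_integral_eq_integral) (simp_all add: continuous_on_power continuous_on_norm)
    finally show ?thesis .
  qed
  have "(\<Sum>n. \<integral>\<^sup>+z. indicator (cball 0 R) z * ennreal ((cmod (a n * z ^ n))\<^sup>2) \<partial>gauss_measure t)
     = (\<Sum>n. ennreal (LINT z|gauss_measure t. ?I z * (cmod (a n * z ^ n))\<^sup>2))"
    by (subst nn) (auto intro!: continuous_intros)
  also have "\<dots> = ennreal (LINT z|gauss_measure t. ?I z * (cmod (f z))\<^sup>2)"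
    using S by (intro suminf_ennreal_eq) auto
  also have "\<dots> = (\<integral>\<^sup>+z. indicator (cball 0 R) z * ennreal ((cmod (f z))\<^sup>2) \<partial>gauss_measure t)"
    using nn[OF f] by simp
  finally show ?thesis ..
qed

lemma nn_integral_cball_LIMSEQ:
  fixes h :: "complex \<Rightarrow> ennreal"
  assumes [measurable]: "h \<in> borel_measurable borel"
  shows "(\<lambda>k. \<integral>\<^sup>+z. indicator (cball 0 (real k)) z * h z \<partial>gauss_measure t) \<longlonglongrightarrow> (\<integral>\<^sup>+z. h z \<partial>gauss_measure t)"
proof (rule nn_integral_LIMSEQ)
  show "incseq (\<lambda>k z. indicator (cball 0 (real k)) z * h z)"
    by (auto simp: incseq_def le_fun_def split: split_indicator)
  fix z :: complex
  show "(\<lambda>k. indicator (cball 0 (real k)) z * h z) \<longlonglongrightarrow> h z"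
  proof (rule tendsto_eventually)
    show "\<forall>\<^sub>F k in sequentially. indicator (cball 0 (real k)) z * h z = h z"
      using eventually_ge_at_top[of "nat \<lceil>cmod z\<rceil>"]
      by eventually_elim (auto split: split_indicator)
  qed
qed simp

text \<open>Exhausting the plane by discs, both sides are limits of the same integrals. The values
  lie in [0, \<infinity>], so the identity also covers f that are not square integrable.\<close>

lemma parseval_power_series:
  assumes t: "t > 0" and sums: "\<And>z. (\<lambda>n. a n * z ^ n) sums f z"
  shows "(\<integral>\<^sup>+z. ennreal ((cmod (f z))\<^sup>2) \<partial>gauss_measure t) = (\<Sum>n. ennreal ((cmod (a n))\<^sup>2 * (fact n * t ^ n)))"
proof -
  have [measurable]: "f \<in> borel_measurable borel"
    using entire_power_series[OF sums]
    by (intro borel_measurable_continuous_onI holomorphic_on_imp_continuous_on)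
  let ?h = "\<lambda>z. \<Sum>n. ennreal ((cmod (a n * z ^ n))\<^sup>2)"
  have "(\<integral>\<^sup>+z. indicator (cball 0 R) z * ennreal ((cmod (f z))\<^sup>2) \<partial>gauss_measure t)
     = (\<integral>\<^sup>+z. indicator (cball 0 R) z * ?h z \<partial>gauss_measure t)" for R
    unfolding parseval_cball[OF t sums]
    by (subst nn_integral_suminf[symmetric]) simp_all
  note eq = this
  have "(\<integral>\<^sup>+z. ennreal ((cmod (f z))\<^sup>2) \<partial>gauss_measure t) = (\<integral>\<^sup>+z. ?h z \<partial>gauss_measure t)"
  proof (rule LIMSEQ_unique)
    show "(\<lambda>k. \<integral>\<^sup>+z. indicator (cball 0 (real k)) z * ?h z \<partial>gauss_measure t) \<longlonglongrightarrow> (\<integral>\<^sup>+z. ennreal ((cmod (f z))\<^sup>2) \<partial>gauss_measure t)"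
      unfolding eq[symmetric] by (rule nn_integral_cball_LIMSEQ) measurable
    show "(\<lambda>k. \<integral>\<^sup>+z. indicator (cball 0 (real k)) z * ?h z \<partial>gauss_measure t) \<longlonglongrightarrow> (\<integral>\<^sup>+z. ?h z \<partial>gauss_measure t)"
      by (rule nn_integral_cball_LIMSEQ) measurable
  qed
  also have "\<dots> = (\<Sum>n. \<integral>\<^sup>+z. ennreal ((cmod (a n * z ^ n))\<^sup>2) \<partial>gauss_measure t)"
    by (rule nn_integral_suminf) auto
  also have "(\<lambda>n. \<integral>\<^sup>+z. ennreal ((cmod (a n * z ^ n))\<^sup>2) \<partial>gauss_measure t) = (\<lambda>n. ennreal ((cmod (a n))\<^sup>2 * (fact n * t ^ n)))"
  proof
    fix n
    have "(\<integral>\<^sup>+z. ennreal ((cmod (a n * z ^ n))\<^sup>2) \<partial>gauss_measure t)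
      = (\<integral>\<^sup>+z. ennreal ((cmod (a n))\<^sup>2) * ennreal ((cmod z) ^ (2 * n)) \<partial>gauss_measure t)"
      by (intro nn_integral_cong) (simp add: norm_mult norm_power power_mult_distrib power_even_eq ennreal_mult)
    also have "\<dots> = ennreal ((cmod (a n))\<^sup>2 * (fact n * t ^ n))"
      using nn_integral_gauss_moment[OF t, of n] t by (subst nn_integral_cmult) (auto simp: ennreal_mult)
    finally show "(\<integral>\<^sup>+z. ennreal ((cmod (a n * z ^ n))\<^sup>2) \<partial>gauss_measure t) = ennreal ((cmod (a n))\<^sup>2 * (fact n * t ^ n))" .
  qed
  finally show ?thesis .
qed

section \<open>Power series expansions in the Fock space\<close>

text \<open>A relation instead of a map: it requires neither \<open>f \<in> fock t\<close> nor
  \<open>x \<in> ell2\<close>, and sums, multiples, rotations and operators can be transferred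
  through it in either direction. Coefficients refer to the normalised basis, so that the Parseval
  identity carries no weights.\<close>

definition expands :: "real \<Rightarrow> (nat \<Rightarrow> complex) \<Rightarrow> (complex \<Rightarrow> complex) \<Rightarrow> bool"
  where "expands t x f \<longleftrightarrow> (\<forall>z. (\<lambda>n. x n * fock_basis t n z) sums f z)"

lemma expands_power_series:
  "expands t x f \<longleftrightarrow> (\<forall>z. (\<lambda>n. x n / complex_of_real (sqrt (fact n * t ^ n)) * z ^ n) sums f z)"
  by (simp add: expands_def fock_basis_def)

lemma expands_add: "expands t x f \<Longrightarrow> expands t y g \<Longrightarrow> expands t (\<lambda>n. x n + y n) (\<lambda>z. f z + g z)"
  by (simp add: expands_def ring_distribs sums_add)

lemma expands_scale: "expands t x f \<Longrightarrow> expands t (\<lambda>n. c * x n) (\<lambda>z. c * f z)"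
  by (simp add: expands_def mult.assoc sums_mult)

lemma expands_rot: "expands t x f \<Longrightarrow> expands t (\<lambda>n. \<zeta> ^ n * x n) (rot \<zeta> f)"
  unfolding expands_def rot_def
proof (intro allI)
  fix z assume "\<forall>z. (\<lambda>n. x n * fock_basis t n z) sums f z"
  then have "(\<lambda>n. x n * fock_basis t n (\<zeta> * z)) sums f (\<zeta> * z)" by blast
  then show "(\<lambda>n. \<zeta> ^ n * x n * fock_basis t n z) sums f (\<zeta> * z)"
    by (simp add: fock_basis_def power_mult_distrib mult_ac)
qed

lemma expands_fock_basis: "expands t (unit_seq m) (fock_basis t m)"
proof -
  have "(\<lambda>n. unit_seq m n * fock_basis t n z) = (\<lambda>n. if n = m then fock_basis t n z else 0)" for z
    by (auto simp: unit_seq_def)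
  then show ?thesis
    using sums_single[of m "\<lambda>n. fock_basis t n _"] by (simp add: expands_def)
qed

lemma expands_unique_fun: "expands t x f \<Longrightarrow> expands t x g \<Longrightarrow> f = g"
  by (auto simp: expands_def fun_eq_iff intro: sums_unique2)

lemma expands_parseval:
  assumes "t > 0" "expands t x f"
  shows "(\<integral>\<^sup>+z. ennreal ((cmod (f z))\<^sup>2) \<partial>gauss_measure t) = (\<Sum>n. ennreal ((cmod (x n))\<^sup>2))"
proof -
  have "(cmod (x n / complex_of_real (sqrt (fact n * t ^ n))))\<^sup>2 * (fact n * t ^ n) = (cmod (x n))\<^sup>2" for n
    using assms(1) by (simp add: norm_divide power_divide)
  then show ?thesis
    using assms parseval_power_series[of t "\<lambda>n. x n / complex_of_real (sqrt (fact n * t ^ n))" f]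
    by (simp only: expands_power_series)
qed

lemma expands_holomorphic: "expands t x f \<Longrightarrow> f holomorphic_on UNIV"
  using entire_power_series[of "\<lambda>n. x n / complex_of_real (sqrt (fact n * t ^ n))" f]
  by (simp only: expands_power_series)

lemma expands_measurable: "expands t x f \<Longrightarrow> f \<in> borel_measurable borel"
  by (intro borel_measurable_continuous_onI holomorphic_on_imp_continuous_on expands_holomorphic)

text \<open>The difference sequence expands the zero function, and Parseval makes every square in a
  vanishing sum zero.\<close>

lemma expands_unique:
  assumes "t > 0" "expands t x f" "expands t y f"
  shows "x = y"
proof
  fix n
  have "expands t (\<lambda>n. x n - y n) (\<lambda>z. 0)"
    using expands_add[OF assms(2) expands_scale[OF assms(3), of "-1"]] by simp
  from expands_parseval[OF assms(1) this] have "(\<Sum>n. ennreal ((cmod (x n - y n))\<^sup>2)) = 0"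
    by simp
  then have "ennreal ((cmod (x n - y n))\<^sup>2) = 0"
    by (subst (asm) suminf_eq_zero_iff) (rule summableI, rule zero_le, blast)
  then show "x n = y n" by (simp add: ennreal_eq_0_iff)
qed

lemma ex_expands:
  assumes "t > 0" "f holomorphic_on UNIV"
  shows "\<exists>x. expands t x f"
proof -
  have "(\<lambda>n. (deriv ^^ n) f 0 / fact n * (z - 0) ^ n) sums f z" for z
    using assms(2) by (intro holomorphic_power_series[of f 0 "cmod z + 1"]) (auto intro: holomorphic_on_subset)
  then have "expands t (\<lambda>n. (deriv ^^ n) f 0 / fact n * complex_of_real (sqrt (fact n * t ^ n))) f"
    using assms(1) by (simp add: expands_power_series)
  then show ?thesis by blast
qed

text \<open>The squared moduli of the basis functions at z sum to exp (|z|^2 / t), so the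
  arithmetic-geometric mean inequality bounds each term by a summable one. This makes every element
  of \<open>ell2\<close> a coefficient sequence.\<close>

lemma ex_expands_ell2:
  assumes "t > 0" "x \<in> ell2"
  shows "\<exists>f. expands t x f"
proof -
  have "summable (\<lambda>n. x n * fock_basis t n z)" for z
  proof (rule summable_comparison_test')
    have "summable (\<lambda>n. inverse (fact n) * ((cmod z)\<^sup>2 / t) ^ n)" by (rule summable_exp)
    moreover have "inverse (fact n) * ((cmod z)\<^sup>2 / t) ^ n = (cmod (fock_basis t n z))\<^sup>2" for n
      using assms(1)
      by (simp add: fock_basis_def norm_divide norm_power power_divide field_simps power_even_eq[symmetric] power_mult[symmetric])
    ultimately have "summable (\<lambda>n. (cmod (fock_basis t n z))\<^sup>2)" by simp
    then show "summable (\<lambda>n. (cmod (x n))\<^sup>2 + (cmod (fock_basis t n z))\<^sup>2)"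
      using assms(2) by (intro summable_add) (auto simp: ell2_def)
    fix n :: nat
    have "2 * cmod (x n) * cmod (fock_basis t n z) \<le> (cmod (x n))\<^sup>2 + (cmod (fock_basis t n z))\<^sup>2"
      by (rule sum_squares_bound)
    moreover have "0 \<le> cmod (x n) * cmod (fock_basis t n z)" by simp
    ultimately show "norm (x n * fock_basis t n z) \<le> (cmod (x n))\<^sup>2 + (cmod (fock_basis t n z))\<^sup>2"
      unfolding norm_mult by linarith
  qed
  then have "expands t x (\<lambda>z. \<Sum>n. x n * fock_basis t n z)"
    by (simp add: expands_def summable_sums)
  then show ?thesis by blast
qed

text \<open>Entire functions are measurable, so integrability is finiteness of the integral in
  [0, \<infinity>], which Parseval turns into finiteness of the sum of squares.\<close>

lemma expands_fock_iff:
  assumes "t > 0" "expands t x f"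
  shows "f \<in> fock t \<longleftrightarrow> x \<in> ell2"
proof -
  have [measurable]: "f \<in> borel_measurable borel" by (rule expands_measurable) fact
  have "integrable (gauss_measure t) (\<lambda>z. (cmod (f z))\<^sup>2) \<longleftrightarrow> (\<Sum>n. ennreal ((cmod (x n))\<^sup>2)) < top"
    unfolding integrable_iff_bounded expands_parseval[OF assms, symmetric] by simp
  also have "\<dots> \<longleftrightarrow> x \<in> ell2"
  proof
    assume "(\<Sum>n. ennreal ((cmod (x n))\<^sup>2)) < top"
    then show "x \<in> ell2"
      unfolding ell2_def by (intro CollectI summable_suminf_not_top) auto
  next
    assume "x \<in> ell2"
    then have "(\<Sum>n. ennreal ((cmod (x n))\<^sup>2)) = ennreal (\<Sum>n. (cmod (x n))\<^sup>2)"
      unfolding ell2_def by (intro suminf_ennreal2) auto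
    then show "(\<Sum>n. ennreal ((cmod (x n))\<^sup>2)) < top"
      by (simp only: ennreal_less_top)
  qed
  finally show ?thesis using expands_holomorphic[OF assms(2)] by (simp add: fock_def)
qed

lemma expands_integral:
  assumes "t > 0" "expands t x f" "x \<in> ell2"
  shows "(LINT z|gauss_measure t. (cmod (f z))\<^sup>2) = (\<Sum>n. (cmod (x n))\<^sup>2)"
proof -
  have [measurable]: "f \<in> borel_measurable borel" by (rule expands_measurable) fact
  have "(LINT z|gauss_measure t. (cmod (f z))\<^sup>2) = enn2real (\<integral>\<^sup>+z. ennreal ((cmod (f z))\<^sup>2) \<partial>gauss_measure t)"
    by (rule integral_eq_nn_integral) auto
  also have "\<dots> = (\<Sum>n. (cmod (x n))\<^sup>2)"
  proof -
    have sx: "summable (\<lambda>n. (cmod (x n))\<^sup>2)" using assms(3) by (simp add: ell2_def)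
    then have "(\<Sum>n. ennreal ((cmod (x n))\<^sup>2)) = ennreal (\<Sum>n. (cmod (x n))\<^sup>2)"
      by (intro suminf_ennreal2) auto
    then show ?thesis
      unfolding expands_parseval[OF assms(1,2)] using sx by (simp only: enn2real_ennreal suminf_nonneg zero_le_power2)
  qed
  finally show ?thesis .
qed

lemma expands_fock_norm:
  "t > 0 \<Longrightarrow> expands t x f \<Longrightarrow> x \<in> ell2 \<Longrightarrow> fock_norm t f = ell2_norm x"
  by (simp add: fock_norm_def ell2_norm_def expands_integral)

section \<open>Inner products, coordinates and the adjoint of a rotation\<close>

lemma complex_polarization:
  fixes u v :: complex
  shows "u * cnj v = (1/4) * complex_of_real ((cmod (u + v))\<^sup>2) - (1/4) * complex_of_real ((cmod (u + (-1) * v))\<^sup>2)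
      + (\<i>/4) * complex_of_real ((cmod (u + \<i> * v))\<^sup>2) - (\<i>/4) * complex_of_real ((cmod (u + (-\<i>) * v))\<^sup>2)"
  unfolding complex_norm_square by (simp add: algebra_simps)

text \<open>Polarization expresses both the terms of the series and the integrand through four
  squared moduli, to which the norm identity applies.\<close>

lemma expands_fock_inner:
  assumes t: "t > 0" and x: "expands t x f" "x \<in> ell2" and y: "expands t y g" "y \<in> ell2"
  shows "(\<lambda>n. x n * cnj (y n)) sums fock_inner t f g"
proof -
  define P where "P c = complex_of_real (\<Sum>n. (cmod (x n + c * y n))\<^sup>2)" for c
  have e: "expands t (\<lambda>n. x n + c * y n) (\<lambda>z. f z + c * g z)" for c
    by (intro expands_add expands_scale x y)
  have l: "(\<lambda>n. x n + c * y n) \<in> ell2" for c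
    by (intro ell2_add(1) ell2_scale(1) x y)
  have s: "(\<lambda>n. complex_of_real ((cmod (x n + c * y n))\<^sup>2)) sums P c" for c
    unfolding P_def using l[of c] by (intro sums_of_real summable_sums) (simp add: ell2_def)
  have i: "has_bochner_integral (gauss_measure t) (\<lambda>z. complex_of_real ((cmod (f z + c * g z))\<^sup>2)) (P c)" for c
  proof -
    have "has_bochner_integral (gauss_measure t) (\<lambda>z. (cmod (f z + c * g z))\<^sup>2) (\<Sum>n. (cmod (x n + c * y n))\<^sup>2)"
      using expands_integral[OF t e l] expands_fock_iff[OF t e, of c] l[of c]
      by (simp add: has_bochner_integral_iff fock_def)
    then show ?thesis unfolding P_def by (rule has_bochner_integral_of_real)
  qed
  let ?S = "(1/4) * P 1 - (1/4) * P (-1) + (\<i>/4) * P \<i> - (\<i>/4) * P (-\<i>)"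
  \<comment> \<open>The polarization identity contains u + v without a factor 1, so the case c = 1
    is rewritten to match it; the other three keep the form u + c * v.\<close>
  have s1: "(\<lambda>n. complex_of_real ((cmod (x n + y n))\<^sup>2)) sums P 1"
    using s[of 1] by simp
  have "(\<lambda>n. x n * cnj (y n)) sums ?S"
    by (subst complex_polarization) (rule sums_diff[OF sums_add[OF sums_diff[OF sums_mult[OF s1] sums_mult[OF s]] sums_mult[OF s]] sums_mult[OF s]])
  note S = this
  have i1: "has_bochner_integral (gauss_measure t) (\<lambda>z. complex_of_real ((cmod (f z + g z))\<^sup>2)) (P 1)"
    using i[of 1] by simp
  note m = has_bochner_integral_mult_right[OF i]
  have "has_bochner_integral (gauss_measure t) (\<lambda>z. f z * cnj (g z)) ?S"
    by (subst complex_polarization) (rule has_bochner_integral_diff[OF has_bochner_integral_add[OF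
        has_bochner_integral_diff[OF has_bochner_integral_mult_right[OF i1] m] m] m])
  then have "fock_inner t f g = ?S"
    unfolding fock_inner_def by (rule has_bochner_integral_integral_eq)
  with S show ?thesis by simp
qed

lemma fock_cases:
  assumes "t > 0" "f \<in> fock t"
  obtains x where "expands t x f" "x \<in> ell2"
  using ex_expands[of t f] expands_fock_iff[of t _ f] assms by (auto simp: fock_def)

lemma ell2_cases:
  assumes "t > 0" "x \<in> ell2"
  obtains f where "expands t x f" "f \<in> fock t"
  using ex_expands_ell2[OF assms] expands_fock_iff[of t x] assms by auto

lemma expands_fock_coords:
  assumes "t > 0" "expands t x f" "x \<in> ell2"
  shows "fock_coords t f = x"
proof
  fix n
  have "(\<lambda>k. x k * cnj (unit_seq n k)) = (\<lambda>k. if k = n then x k else 0)"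
    by (auto simp: unit_seq_def)
  then have "(\<lambda>k. x k * cnj (unit_seq n k)) sums x n"
    using sums_single[of n x] by simp
  then show "fock_coords t f n = x n"
    unfolding fock_coords_def
    by (rule sums_unique2[OF expands_fock_inner[OF assms expands_fock_basis unit_seq_in_ell2]])
qed

lemma expands_fock_coords_self:
  assumes "t > 0" "f \<in> fock t"
  shows "expands t (fock_coords t f) f" and "fock_coords t f \<in> ell2" and "ell2_norm (fock_coords t f) = fock_norm t f"
proof -
  obtain x where "expands t x f" "x \<in> ell2" using fock_cases[OF assms] .
  with assms(1) show "expands t (fock_coords t f) f" "fock_coords t f \<in> ell2" "ell2_norm (fock_coords t f) = fock_norm t f"
    by (simp_all add: expands_fock_coords expands_fock_norm)
qed

lemma inj_on_fock_coords: "t > 0 \<Longrightarrow> inj_on (fock_coords t) (fock t)"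
  by (intro inj_onI expands_unique_fun[of t "fock_coords t _"]) (auto dest: expands_fock_coords_self(1))

lemma fock_coords_inv_into:
  assumes "t > 0" "x \<in> ell2"
  shows "expands t x (inv_into (fock t) (fock_coords t) x)" and "inv_into (fock t) (fock_coords t) x \<in> fock t"
proof -
  obtain f where f: "expands t x f" "f \<in> fock t" using ell2_cases[OF assms] .
  then have "inv_into (fock t) (fock_coords t) x = f"
    using inv_into_f_f[OF inj_on_fock_coords[OF assms(1)] f(2)] expands_fock_coords[OF assms(1) f(1) assms(2)] by simp
  with f show "expands t x (inv_into (fock t) (fock_coords t) x)" "inv_into (fock t) (fock_coords t) x \<in> fock t"
    by simp_all
qed

lemma expands_inv_into:
  assumes "t > 0" "x \<in> ell2" "expands t x f"
  shows "inv_into (fock t) (fock_coords t) x = f"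
  using fock_coords_inv_into[OF assms(1,2)] assms(3) by (blast intro: expands_unique_fun)

text \<open>In coordinates \<open>rot \<zeta>\<close> is the diagonal operator with entries
  \<zeta>^n, whose adjoint conjugates the entries. As \<open>adjoint_op\<close> is a definite
  description, every other candidate must be excluded too.\<close>

lemma adjoint_rot:
  assumes t: "t > 0" and \<zeta>: "cmod \<zeta> = 1" and g: "g \<in> fock t"
  shows "adjoint_op (fock t) (fock_inner t) (rot \<zeta>) g = rot (cnj \<zeta>) g"
  unfolding adjoint_op_def
proof (rule the_equality)
  obtain y where y: "expands t y g" "y \<in> ell2" using fock_cases[OF t g] .
  have y': "expands t (\<lambda>n. cnj \<zeta> ^ n * y n) (rot (cnj \<zeta>) g)" "(\<lambda>n. cnj \<zeta> ^ n * y n) \<in> ell2"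
    using y \<zeta> by (auto simp: expands_rot ell2_unimodular norm_power)
  have eq: "fock_inner t (rot \<zeta> f) g = fock_inner t f (rot (cnj \<zeta>) g)" if "f \<in> fock t" for f
  proof -
    obtain x where x: "expands t x f" "x \<in> ell2" using fock_cases[OF t \<open>f \<in> fock t\<close>] .
    have x': "expands t (\<lambda>n. \<zeta> ^ n * x n) (rot \<zeta> f)" "(\<lambda>n. \<zeta> ^ n * x n) \<in> ell2"
      using x \<zeta> by (auto simp: expands_rot ell2_unimodular norm_power)
    show ?thesis
      by (rule sums_unique2[OF expands_fock_inner[OF t x' y]])
        (use expands_fock_inner[OF t x y'] in \<open>simp add: mult_ac\<close>)
  qed
  show "rot (cnj \<zeta>) g \<in> fock t \<and> (\<forall>f\<in>fock t. fock_inner t (rot \<zeta> f) g = fock_inner t f (rot (cnj \<zeta>) g))"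
    using expands_fock_iff[OF t y'(1)] y'(2) eq by simp
  fix h assume h: "h \<in> fock t \<and> (\<forall>f\<in>fock t. fock_inner t (rot \<zeta> f) g = fock_inner t f h)"
  obtain w where w: "expands t w h" "w \<in> ell2" using fock_cases[OF t] h by blast
  \<comment> \<open>Pairing with basis functions recovers the coefficients of a candidate h, so it
    agrees with the one found.\<close>
  have "cnj (w n) = cnj (cnj \<zeta> ^ n * y n)" for n
  proof -
    have "fock_basis t n \<in> fock t"
      using expands_fock_iff[OF t expands_fock_basis] by simp
    then have "fock_inner t (fock_basis t n) h = fock_inner t (fock_basis t n) (rot (cnj \<zeta>) g)"
      using h eq by simp
    moreover have "fock_inner t (fock_basis t n) k = cnj (v n)" if "expands t v k" "v \<in> ell2" for v k
    proof -
      have "(\<lambda>k. unit_seq n k * cnj (v k)) = (\<lambda>k. if k = n then cnj (v k) else 0)"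
        by (auto simp: unit_seq_def)
      then have "(\<lambda>k. unit_seq n k * cnj (v k)) sums cnj (v n)"
        using sums_single[of n "\<lambda>k. cnj (v k)"] by simp
      then show ?thesis
        by (rule sums_unique2[OF expands_fock_inner[OF t expands_fock_basis unit_seq_in_ell2 that]])
    qed
    ultimately show ?thesis using w y' by simp
  qed
  then have "w = (\<lambda>n. cnj \<zeta> ^ n * y n)" by (intro ext) (simp only: complex_cnj_cancel_iff)
  then show "h = rot (cnj \<zeta>) g"
    using w(1) y'(1) expands_unique_fun by blast
qed

section \<open>Rotation continuity on the sequence space\<close>

lemma ell2_opsI:
  assumes "\<And>x. x \<in> ell2 \<Longrightarrow> B x \<in> ell2"
    and "\<And>x y. x \<in> ell2 \<Longrightarrow> y \<in> ell2 \<Longrightarrow> B (\<lambda>n. x n + y n) = (\<lambda>n. B x n + B y n)"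
    and "\<And>c x. x \<in> ell2 \<Longrightarrow> B (\<lambda>n. c * x n) = (\<lambda>n. c * B x n)"
    and "\<And>x. x \<in> ell2 \<Longrightarrow> ell2_norm (B x) \<le> K * ell2_norm x"
  shows "B \<in> ell2_ops"
  using assms unfolding bounded_ops_def by blast

lemma ell2_ops_minus:
  assumes A: "A \<in> ell2_ops" and B: "B \<in> ell2_ops"
  shows "(\<lambda>x n. A x n - B x n) \<in> ell2_ops"
proof -
  obtain K where K: "\<And>f. f \<in> ell2 \<Longrightarrow> ell2_norm (A f) \<le> K * ell2_norm f"
    using bounded_opsE[OF A ell2_norm_nonneg] by blast
  obtain L where L: "\<And>f. f \<in> ell2 \<Longrightarrow> ell2_norm (B f) \<le> L * ell2_norm f"
    using bounded_opsE[OF B ell2_norm_nonneg] by blast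
  show ?thesis
  proof (rule ell2_opsI[where K = "K + L"])
    fix x y assume x: "x \<in> ell2" and y: "y \<in> ell2"
    show "(\<lambda>n. A (\<lambda>n. x n + y n) n - B (\<lambda>n. x n + y n) n) = (\<lambda>n. A x n - B x n + (A y n - B y n))"
      by (simp add: bounded_opsD(2)[OF A x y] bounded_opsD(2)[OF B x y] algebra_simps)
  next
    fix x c assume x: "x \<in> ell2"
    show "(\<lambda>n. A x n - B x n) \<in> ell2"
      by (intro ell2_diff bounded_opsD(1)[OF A] bounded_opsD(1)[OF B] x)
    show "(\<lambda>n. A (\<lambda>n. c * x n) n - B (\<lambda>n. c * x n) n) = (\<lambda>n. c * (A x n - B x n))"
      by (simp add: bounded_opsD(3)[OF A x] bounded_opsD(3)[OF B x] algebra_simps)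
    show "ell2_norm (\<lambda>n. A x n - B x n) \<le> (K + L) * ell2_norm x"
      using ell2_diff(2)[OF bounded_opsD(1)[OF A x] bounded_opsD(1)[OF B x]] K[OF x] L[OF x]
      by (simp add: algebra_simps)
  qed
qed

lemma ell2_ops_zero: "(\<lambda>x n. 0) \<in> ell2_ops"
  by (rule ell2_opsI[where K = 0]) auto

lemma ell2_ops_sum:
  assumes "finite K" "\<And>k. k \<in> K \<Longrightarrow> D k \<in> ell2_ops"
  shows "(\<lambda>x n. \<Sum>k\<in>K. D k x n) \<in> ell2_ops"
  using assms
proof (induction K rule: finite_induct)
  case empty
  then show ?case by (simp add: ell2_ops_zero)
next
  case (insert k K)
  \<comment> \<open>Sums are reduced to closure under differences by subtracting the negated partial
    sum.\<close>
  have "(\<lambda>x n. D k x n - (0 - (\<Sum>k\<in>K. D k x n))) \<in> ell2_ops"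
    by (intro ell2_ops_minus ell2_ops_zero) (use insert in auto)
  then show ?case using insert by simp
qed

lemma ell2_op_norm:
  assumes B: "B \<in> ell2_ops"
  shows "x \<in> ell2 \<Longrightarrow> ell2_norm (B x) \<le> op_norm ell2 ell2_norm B * ell2_norm x"
    and "0 \<le> op_norm ell2 ell2_norm B"
proof -
  obtain K where K: "\<And>f. f \<in> ell2 \<Longrightarrow> ell2_norm (B f) \<le> K * ell2_norm f"
    using bounded_opsE[OF B ell2_norm_nonneg] by blast
  show "x \<in> ell2 \<Longrightarrow> ell2_norm (B x) \<le> op_norm ell2 ell2_norm B * ell2_norm x"
    using ell2_op_norm_bound(1)[of B K, OF K bounded_opsD(3)[OF B] bounded_opsD(1)[OF B]] by simp
  show "0 \<le> op_norm ell2 ell2_norm B"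
    using ell2_op_norm_bound(2)[of B K, OF K bounded_opsD(3)[OF B] bounded_opsD(1)[OF B] zero_in_ell2] by simp
qed

lemma ell2_op_norm_leI:
  assumes "0 \<le> K" "\<And>x. x \<in> ell2 \<Longrightarrow> ell2_norm (B x) \<le> K * ell2_norm x"
  shows "op_norm ell2 ell2_norm B \<le> K"
proof (rule op_norm_le[where ?f0.0 = "\<lambda>n. 0"])
  fix f assume f: "f \<in> ell2" "ell2_norm f \<le> 1"
  have "ell2_norm (B f) \<le> K * ell2_norm f" by (rule assms(2)[OF f(1)])
  also have "\<dots> \<le> K" using f assms(1) by (simp add: mult_left_le)
  finally show "ell2_norm (B f) \<le> K" .
qed (use assms(1) in auto)

text \<open>Finitely many coordinates of the image are limits over truncated inputs. The Fejer
  average is an exact finite sum only for such inputs and finitely many outputs, and this closes the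
  gap.\<close>

lemma ell2_norm_le_trunc:
  assumes R: "R \<in> ell2_ops" and x: "x \<in> ell2" and "0 \<le> c"
    and le: "\<And>S S'. L2_set (\<lambda>n. cmod (R (trunc S x) n)) {..<S'} \<le> c"
  shows "ell2_norm (R x) \<le> c"
proof (rule ell2_normI(2)[OF \<open>0 \<le> c\<close>])
  fix S'
  have "(\<lambda>S. L2_set (\<lambda>n. cmod (R (trunc S x) n)) {..<S'}) \<longlonglongrightarrow> L2_set (\<lambda>n. cmod (R x n)) {..<S'}"
    unfolding L2_set_def by (intro tendsto_intros ell2_ops_trunc_LIMSEQ[OF R x])
  then show "L2_set (\<lambda>n. cmod (R x n)) {..<S'} \<le> c"
    using le by (intro LIMSEQ_le_const2) auto
qed

section \<open>Conjugation by rotations and banded operators\<close>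

definition modulate :: "complex \<Rightarrow> (nat \<Rightarrow> complex) \<Rightarrow> nat \<Rightarrow> complex"
  where "modulate \<zeta> x = (\<lambda>n. \<zeta> ^ n * x n)"

text \<open>Conjugation of an operator by the rotation, in coordinates: on the circle
  \<open>cnj \<zeta>\<close> is the inverse of \<zeta>, so \<open>modulate (cnj \<zeta>)\<close>
  represents the adjoint.\<close>

definition twist :: "complex \<Rightarrow> ((nat \<Rightarrow> complex) \<Rightarrow> nat \<Rightarrow> complex) \<Rightarrow> (nat \<Rightarrow> complex) \<Rightarrow> nat \<Rightarrow> complex"
  where "twist \<zeta> B x = modulate \<zeta> (B (modulate (cnj \<zeta>) x))"

lemma modulate_ell2:
  assumes "cmod \<zeta> = 1"
  shows "modulate \<zeta> x \<in> ell2 \<longleftrightarrow> x \<in> ell2" "ell2_norm (modulate \<zeta> x) = ell2_norm x"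
  unfolding modulate_def by (simp_all add: ell2_unimodular norm_power assms)

lemma ell2_norm_twist_le:
  assumes "cmod \<zeta> = 1" "\<And>x. x \<in> ell2 \<Longrightarrow> ell2_norm (B x) \<le> K * ell2_norm x" "x \<in> ell2"
  shows "ell2_norm (twist \<zeta> B x) \<le> K * ell2_norm x"
  using assms(2)[of "modulate (cnj \<zeta>) x"] assms(1,3) by (simp add: twist_def modulate_ell2)

lemma twist_in_ell2_ops:
  assumes B: "B \<in> ell2_ops" and \<zeta>: "cmod \<zeta> = 1"
  shows "twist \<zeta> B \<in> ell2_ops"
proof -
  obtain K where K: "\<And>f. f \<in> ell2 \<Longrightarrow> ell2_norm (B f) \<le> K * ell2_norm f"
    using bounded_opsE[OF B ell2_norm_nonneg] by blast
  have m: "modulate (cnj \<zeta>) x \<in> ell2" if "x \<in> ell2" for x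
    using that \<zeta> by (simp add: modulate_ell2)
  show ?thesis
  proof (rule ell2_opsI[where K = K])
    fix x y assume x: "x \<in> ell2" and y: "y \<in> ell2"
    have "modulate (cnj \<zeta>) (\<lambda>n. x n + y n) = (\<lambda>n. modulate (cnj \<zeta>) x n + modulate (cnj \<zeta>) y n)"
      by (simp add: modulate_def ring_distribs)
    then show "twist \<zeta> B (\<lambda>n. x n + y n) = (\<lambda>n. twist \<zeta> B x n + twist \<zeta> B y n)"
      using bounded_opsD(2)[OF B m[OF x] m[OF y]] by (simp add: twist_def) (simp add: modulate_def ring_distribs)
  next
    fix x c assume x: "x \<in> ell2"
    have "modulate (cnj \<zeta>) (\<lambda>n. c * x n) = (\<lambda>n. c * modulate (cnj \<zeta>) x n)"
      by (simp add: modulate_def mult_ac)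
    then show "twist \<zeta> B (\<lambda>n. c * x n) = (\<lambda>n. c * twist \<zeta> B x n)"
      using bounded_opsD(3)[OF B m[OF x]] by (simp add: twist_def) (simp add: modulate_def mult_ac)
    show "ell2_norm (twist \<zeta> B x) \<le> K * ell2_norm x"
      using ell2_norm_twist_le[OF \<zeta> K x] by simp
    show "twist \<zeta> B x \<in> ell2"
      using x \<zeta> bounded_opsD(1)[OF B m] by (simp add: twist_def modulate_ell2)
  qed
qed

text \<open>\<open>B (unit_seq m) n\<close> is the entry in column m and row n, so a positive k lies
  above the main diagonal. Unlike \<open>band\<close>, this makes no reference to the Fock space and
  restricts only matrix entries.\<close>

definition banded :: "int \<Rightarrow> ((nat \<Rightarrow> complex) \<Rightarrow> nat \<Rightarrow> complex) \<Rightarrow> bool"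
  where "banded k B \<longleftrightarrow> (\<forall>m n. int m - int n \<noteq> k \<longrightarrow> B (unit_seq m) n = 0)"

text \<open>The entry in row n and column m is multiplied by \<zeta>^n and by the m-th power of its
  conjugate, that is by the conjugate to the power m - n, which equals k wherever the entry is
  nonzero.\<close>

lemma twist_banded:
  assumes B: "B \<in> ell2_ops" "banded k B" and \<zeta>: "cmod \<zeta> = 1" and x: "x \<in> ell2"
  shows "twist \<zeta> B x n = cnj \<zeta> powi k * B x n"
proof -
  have m: "modulate (cnj \<zeta>) x \<in> ell2"
    using x \<zeta> by (simp add: modulate_ell2)
  have z: "\<zeta> * cnj \<zeta> = 1" "\<zeta> \<noteq> 0"
    using \<zeta> complex_norm_square[of \<zeta>] by auto
  have c: "\<zeta> ^ n * cnj \<zeta> ^ m = cnj \<zeta> powi (int m - int n)" for m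
  proof -
    have "\<zeta> ^ n * cnj \<zeta> ^ n = 1" using z by (simp add: power_mult_distrib[symmetric])
    then show ?thesis using z by (simp add: power_int_diff field_simps)
  qed
  have "\<zeta> ^ n * (B (unit_seq m) n * modulate (cnj \<zeta>) x m) = cnj \<zeta> powi k * (B (unit_seq m) n * x m)" for m
  proof (cases "int m - int n = k")
    case True
    then show ?thesis using c[of m] by (simp add: modulate_def mult_ac)
  next
    case False
    then show ?thesis using B(2) by (simp add: banded_def)
  qed
  then have "(\<lambda>m. cnj \<zeta> powi k * (B (unit_seq m) n * x m)) sums twist \<zeta> B x n"
    using sums_mult[OF ell2_ops_matrix_sums[OF B(1) m, of n], of "\<zeta> ^ n"]
    by (simp only: twist_def modulate_def[of \<zeta>])
  then show ?thesis
    by (rule sums_unique2) (intro sums_mult ell2_ops_matrix_sums B x)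
qed

definition rotation_continuous :: "((nat \<Rightarrow> complex) \<Rightarrow> nat \<Rightarrow> complex) \<Rightarrow> bool"
  where "rotation_continuous B \<longleftrightarrow>
    ((\<lambda>\<zeta>. op_norm ell2 ell2_norm (\<lambda>x n. twist \<zeta> B x n - B x n)) \<longlongrightarrow> 0) (at 1 within sphere 0 1)"

text \<open>The error is measured by norm bounds on \<open>ell2\<close>, and the D k are only
  required to be bounded and banded. Elements of \<open>band_operators t\<close> are constrained as
  functions outside \<open>ell2\<close> as well, which an explicit formula such as a Fejer mean need
  not satisfy.\<close>

definition band_approximable :: "((nat \<Rightarrow> complex) \<Rightarrow> nat \<Rightarrow> complex) \<Rightarrow> bool"
  where "band_approximable B \<longleftrightarrow> (\<forall>\<epsilon>>0. \<exists>K D. finite K \<and> (\<forall>k\<in>K. D k \<in> ell2_ops \<and> banded k (D k)) \<and>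
     (\<forall>x\<in>ell2. ell2_norm (\<lambda>n. B x n - (\<Sum>k\<in>K. D k x n)) \<le> \<epsilon> * ell2_norm x))"

text \<open>The banded part varies continuously, as only finitely many scalar factors move; the
  remainder R is small and stays small under conjugation, which preserves norms.\<close>

lemma band_approximable_imp_rotation_continuous:
  assumes B: "B \<in> ell2_ops" and appr: "band_approximable B"
  shows "rotation_continuous B"
  unfolding rotation_continuous_def
proof (rule tendstoI)
  fix \<epsilon> :: real assume "\<epsilon> > 0"
  then have "\<epsilon> / 4 > 0" by simp
  note ex = appr[unfolded band_approximable_def, rule_format, OF this]
  obtain K D where KD: "finite K \<and> (\<forall>k\<in>K. D k \<in> ell2_ops \<and> banded k (D k)) \<and>
     (\<forall>x\<in>ell2. ell2_norm (\<lambda>n. B x n - (\<Sum>k\<in>K. D k x n)) \<le> \<epsilon> / 4 * ell2_norm x)"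
    using ex by (elim exE)
  have fin: "finite K" using KD by (rule conjunct1)
  have D: "D k \<in> ell2_ops" "banded k (D k)" if "k \<in> K" for k
    using KD that by simp_all
  have le: "ell2_norm (\<lambda>n. B x n - (\<Sum>k\<in>K. D k x n)) \<le> \<epsilon> / 4 * ell2_norm x" if "x \<in> ell2" for x
    using KD that by simp
  define R where "R x = (\<lambda>n. B x n - (\<Sum>k\<in>K. D k x n))" for x
  define C where "C k = op_norm ell2 ell2_norm (D k)" for k
  \<comment> \<open>\<open>h \<zeta>\<close> bounds the operator norm of the change of the banded
    part; as a finite sum of continuous terms it tends to its value 0 at \<zeta> = 1.\<close>
  define h where "h \<zeta> = (\<Sum>k\<in>K. cmod (cnj \<zeta> powi k - 1) * C k)" for \<zeta>
  have R: "R \<in> ell2_ops"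
    unfolding R_def using ell2_ops_minus[OF B ell2_ops_sum[OF fin D(1)]] by simp
  have "(h \<longlongrightarrow> (\<Sum>k\<in>K. cmod (cnj 1 powi k - 1) * C k)) (at 1 within sphere 0 1)"
    unfolding h_def by (intro tendsto_intros) auto
  then have "(h \<longlongrightarrow> 0) (at 1 within sphere 0 1)" by simp
  then have "\<forall>\<^sub>F \<zeta> in at 1 within sphere 0 1. h \<zeta> < \<epsilon> / 4"
    using \<open>\<epsilon> > 0\<close> by (intro order_tendstoD(2)) auto
  moreover have "\<forall>\<^sub>F \<zeta> in at 1 within sphere 0 1. \<zeta> \<in> sphere (0::complex) 1"
    by (simp add: eventually_at_filter)
  ultimately show "\<forall>\<^sub>F \<zeta> in at 1 within sphere 0 1. dist (op_norm ell2 ell2_norm (\<lambda>x n. twist \<zeta> B x n - B x n)) 0 < \<epsilon>"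
  proof eventually_elim
    case (elim \<zeta>)
    then have \<zeta>: "cmod \<zeta> = 1" by simp
    have h0: "0 \<le> h \<zeta>"
      unfolding h_def C_def by (intro sum_nonneg mult_nonneg_nonneg norm_ge_zero ell2_op_norm(2) D(1))
    \<comment> \<open>One quarter each for R and its conjugate; with h \<zeta> < \<epsilon> / 4 the
      total stays strictly below \<epsilon>.\<close>
    have "op_norm ell2 ell2_norm (\<lambda>x n. twist \<zeta> B x n - B x n) \<le> \<epsilon> / 4 + \<epsilon> / 4 + h \<zeta>"
    proof (rule ell2_op_norm_leI)
      show "0 \<le> \<epsilon> / 4 + \<epsilon> / 4 + h \<zeta>" using h0 \<open>\<epsilon> > 0\<close> by simp
      fix x :: "nat \<Rightarrow> complex" assume x: "x \<in> ell2"
      have Rx: "R x = (\<lambda>n. B x n - (\<Sum>k\<in>K. D k x n))" by (simp add: R_def)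
      define v where "v k = (\<lambda>n. (cnj \<zeta> powi k - 1) * D k x n)" for k
      have v: "v k \<in> ell2" "ell2_norm (v k) \<le> (cmod (cnj \<zeta> powi k - 1) * C k) * ell2_norm x" if "k \<in> K" for k
      proof -
        have Dx: "D k x \<in> ell2" by (rule bounded_opsD(1)[OF D(1)[OF that] x])
        show "v k \<in> ell2" unfolding v_def by (rule ell2_scale(1)[OF Dx])
        show "ell2_norm (v k) \<le> (cmod (cnj \<zeta> powi k - 1) * C k) * ell2_norm x"
          unfolding v_def ell2_scale(2)[OF Dx] C_def mult.assoc
          by (intro mult_left_mono ell2_op_norm(1) D(1) that x) auto
      qed
      have "(\<lambda>n. twist \<zeta> B x n - B x n) = (\<lambda>n. (twist \<zeta> R x n - R x n) + (\<Sum>k\<in>K. v k n))"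
      proof
        fix n
        have "twist \<zeta> B x n = twist \<zeta> R x n + (\<Sum>k\<in>K. twist \<zeta> (D k) x n)"
          by (simp add: twist_def modulate_def R_def algebra_simps sum_distrib_left)
        also have "(\<Sum>k\<in>K. twist \<zeta> (D k) x n) = (\<Sum>k\<in>K. cnj \<zeta> powi k * D k x n)"
          by (intro sum.cong refl twist_banded D \<zeta> x)
        finally show "twist \<zeta> B x n - B x n = (twist \<zeta> R x n - R x n) + (\<Sum>k\<in>K. v k n)"
          using fun_cong[OF Rx] by (simp add: v_def algebra_simps sum_subtractf)
      qed
      moreover have "ell2_norm (\<lambda>n. (twist \<zeta> R x n - R x n) + (\<Sum>k\<in>K. v k n))
         \<le> ell2_norm (\<lambda>n. twist \<zeta> R x n - R x n) + ell2_norm (\<lambda>n. \<Sum>k\<in>K. v k n)"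
        using ell2_sum[of K v, OF fin v(1)] bounded_opsD(1)[OF ell2_ops_minus[OF twist_in_ell2_ops[OF R \<zeta>] R] x]
        by (intro ell2_add) auto
      moreover have "ell2_norm (\<lambda>n. twist \<zeta> R x n - R x n) \<le> ell2_norm (twist \<zeta> R x) + ell2_norm (R x)"
        by (intro ell2_diff bounded_opsD(1)[OF twist_in_ell2_ops[OF R \<zeta>]] bounded_opsD(1)[OF R] x)
      moreover have "ell2_norm (R x) \<le> \<epsilon> / 4 * ell2_norm x"
        unfolding R_def by (rule le[OF x])
      moreover have "ell2_norm (twist \<zeta> R x) \<le> \<epsilon> / 4 * ell2_norm x"
        using \<zeta> le x by (intro ell2_norm_twist_le) (simp_all add: R_def)
      moreover have "ell2_norm (\<lambda>n. \<Sum>k\<in>K. v k n) \<le> h \<zeta> * ell2_norm x"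
      proof -
        have "ell2_norm (\<lambda>n. \<Sum>k\<in>K. v k n) \<le> (\<Sum>k\<in>K. ell2_norm (v k))"
          using ell2_sum[of K v, OF fin v(1)] by simp
        also have "\<dots> \<le> (\<Sum>k\<in>K. (cmod (cnj \<zeta> powi k - 1) * C k) * ell2_norm x)"
          by (intro sum_mono v(2))
        finally show ?thesis by (simp add: h_def sum_distrib_right)
      qed
      ultimately show "ell2_norm (\<lambda>n. twist \<zeta> B x n - B x n) \<le> (\<epsilon> / 4 + \<epsilon> / 4 + h \<zeta>) * ell2_norm x"
        by (simp add: algebra_simps)
    qed
    moreover have "0 \<le> op_norm ell2 ell2_norm (\<lambda>x n. twist \<zeta> B x n - B x n)"
      by (rule ell2_op_norm(2)[OF ell2_ops_minus[OF twist_in_ell2_ops[OF B \<zeta>] B]])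
    ultimately show ?case using elim(1) \<open>\<epsilon> > 0\<close> by simp
  qed
qed

section \<open>Fejer means\<close>

definition unit_root :: "nat \<Rightarrow> nat \<Rightarrow> complex"
  where "unit_root L j = cis (2 * pi * real j / real L)"

text \<open>As a normalised squared modulus the kernel is visibly nonnegative, and the geometric
  series bounds it away from 1.\<close>

definition fejer :: "nat \<Rightarrow> complex \<Rightarrow> real"
  where "fejer N \<zeta> = (cmod (\<Sum>a<N. \<zeta> ^ a))\<^sup>2 / real N"

text \<open>The k-th Fourier coefficient of the kernel, equal to (N - |k|) / N for |k| < N and to 0
  otherwise. It is kept as the number of pairs that arises on multiplying out the squared
  modulus.\<close>

definition fejer_coeff :: "nat \<Rightarrow> int \<Rightarrow> real"
  where "fejer_coeff N k = real (card {(a, b). a < N \<and> b < N \<and> int a - int b = k}) / real N"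

text \<open>A geometric sum whose ratio r satisfies r^L = 1. The exponents being below L, their
  difference is divisible by L only if it is 0, so r \<noteq> 1 for p \<noteq> q.\<close>

lemma sum_unit_roots:
  assumes "p < L" "q < L"
  shows "(\<Sum>j<L. unit_root L j ^ p * cnj (unit_root L j) ^ q) = (if p = q then of_nat L else 0)"
proof -
  define r where "r = cis (2 * pi * ((real p - real q) / real L))"
  have L: "L > 0" using assms by simp
  have "unit_root L j ^ p * cnj (unit_root L j) ^ q = r ^ j" for j
  proof -
    have "unit_root L j ^ p * cnj (unit_root L j) ^ q = cis (real p * (2 * pi * real j / real L) + real q * - (2 * pi * real j / real L))"
      unfolding unit_root_def cis_cnj Complex.DeMoivre cis_mult ..
    also have "\<dots> = r ^ j"
      unfolding r_def Complex.DeMoivre by (simp add: diff_divide_distrib right_diff_distrib mult_ac)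
    finally show ?thesis .
  qed
  then have eq: "(\<Sum>j<L. unit_root L j ^ p * cnj (unit_root L j) ^ q) = (\<Sum>j<L. r ^ j)" by simp
  show ?thesis
  proof (cases "p = q")
    case True
    then show ?thesis unfolding eq by (simp add: r_def)
  next
    case False
    have "r \<noteq> 1"
    proof
      assume "r = 1"
      then have "cos (2 * pi * ((real p - real q) / real L)) = 1"
        by (simp add: r_def complex_eq_iff)
      then obtain i :: int where "2 * pi * ((real p - real q) / real L) = of_int i * 2 * pi"
        unfolding cos_one_2pi_int by blast
      then have "(2 * pi) * ((real p - real q) / real L) = (2 * pi) * of_int i" by (simp only: mult_ac)
      then have "(real p - real q) / real L = of_int i"
        by (subst (asm) mult_left_cancel) simp_all
      then have "real p - real q = of_int i * real L" using L by (simp add: field_simps)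
      then have "of_int (int p - int q) = (of_int (i * int L) :: real)" by simp
      then have "int p - int q = i * int L" by (simp only: of_int_eq_iff)
      then have dvd: "int L dvd int p - int q" by simp
      have small: "\<bar>int p - int q\<bar> < int L" using assms by auto
      have "int p - int q \<noteq> 0" using False by simp
      from dvd_imp_le_int[OF this dvd] small show False by simp
    qed
    moreover have "r ^ L = 1"
    proof -
      have "r ^ L = cis (2 * pi * of_int (int p - int q))"
        unfolding r_def Complex.DeMoivre using L by simp
      then show ?thesis by (simp add: cis_multiple_2pi)
    qed
    ultimately show ?thesis unfolding eq using False by (simp add: geometric_sum)
  qed
qed

lemma cmod_unit_root [simp]: "cmod (unit_root L j) = 1"
  by (simp add: unit_root_def)

text \<open>Multiplying out the kernel leaves the exponents a + n and b + m. Both stay below L, so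
  discrete orthogonality applies and the average over L-th roots of unity is exactly the Fourier
  coefficient, without aliasing.\<close>

lemma fejer_average:
  assumes "N > 0" "N + n < L" "N + m < L"
  shows "(\<Sum>j<L. complex_of_real (fejer N (unit_root L j)) * (unit_root L j ^ n * cnj (unit_root L j) ^ m)) / of_nat L
     = of_real (fejer_coeff N (int m - int n))"
proof -
  let ?w = "unit_root L"
  have "(\<Sum>j<L. complex_of_real (fejer N (?w j)) * (?w j ^ n * cnj (?w j) ^ m))
      = (\<Sum>j<L. \<Sum>a<N. \<Sum>b<N. (?w j ^ (a + n) * cnj (?w j) ^ (b + m)) / of_nat N)"
  proof (rule sum.cong[OF refl])
    fix j
    have "complex_of_real (fejer N (?w j)) = (\<Sum>a<N. \<Sum>b<N. ?w j ^ a * cnj (?w j) ^ b) / of_nat N"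
      unfolding fejer_def of_real_divide complex_norm_square by (simp add: sum_product)
    then show "complex_of_real (fejer N (?w j)) * (?w j ^ n * cnj (?w j) ^ m)
       = (\<Sum>a<N. \<Sum>b<N. (?w j ^ (a + n) * cnj (?w j) ^ (b + m)) / of_nat N)"
      by (simp add: sum_divide_distrib sum_distrib_left sum_distrib_right power_add mult_ac)
  qed
  also have "\<dots> = (\<Sum>a<N. \<Sum>b<N. (\<Sum>j<L. ?w j ^ (a + n) * cnj (?w j) ^ (b + m)) / of_nat N)"
  proof -
    have "(\<Sum>j<L. \<Sum>a<N. \<Sum>b<N. g j a b) = (\<Sum>a<N. \<Sum>b<N. \<Sum>j<L. g j a b)" for g :: "nat \<Rightarrow> nat \<Rightarrow> nat \<Rightarrow> complex"
    proof -
      have "(\<Sum>j<L. \<Sum>a<N. \<Sum>b<N. g j a b) = (\<Sum>a<N. \<Sum>j<L. \<Sum>b<N. g j a b)" by (rule sum.swap)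
      also have "\<dots> = (\<Sum>a<N. \<Sum>b<N. \<Sum>j<L. g j a b)" by (intro sum.cong[OF refl] sum.swap)
      finally show ?thesis .
    qed
    then show ?thesis by (simp only: sum_divide_distrib)
  qed
  also have "\<dots> = (\<Sum>a<N. \<Sum>b<N. (if int a - int b = int m - int n then of_nat L else 0) / of_nat N)"
    using assms by (intro sum.cong refl) (subst sum_unit_roots, auto)
  also have "\<dots> = (\<Sum>(a, b)\<in>{..<N} \<times> {..<N}. (if int a - int b = int m - int n then of_nat L / of_nat N else 0))"
    by (subst sum.cartesian_product[symmetric]) (intro sum.cong refl, simp)
  also have "\<dots> = (\<Sum>(a, b)\<in>{(a, b). a < N \<and> b < N \<and> int a - int b = int m - int n}. of_nat L / of_nat N)"
    by (rule sum.mono_neutral_cong_right) (auto split: if_splits)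
  also have "\<dots> = of_nat (card {(a, b). a < N \<and> b < N \<and> int a - int b = int m - int n}) * (of_nat L / of_nat N)"
    by (simp add: split_def)
  finally show ?thesis using assms by (simp add: fejer_coeff_def)
qed

lemma fejer_nonneg: "0 \<le> fejer N \<zeta>"
  by (simp add: fejer_def)

lemma fejer_coeff_0: "N > 0 \<Longrightarrow> fejer_coeff N 0 = 1"
proof -
  assume "N > 0"
  have "{(a, b). a < N \<and> b < N \<and> int a - int b = 0} = (\<lambda>a. (a, a)) ` {..<N}" by auto
  then show ?thesis using \<open>N > 0\<close> by (simp add: fejer_coeff_def card_image inj_on_def)
qed

lemma fejer_coeff_eq_0: "\<bar>k\<bar> > int N \<Longrightarrow> fejer_coeff N k = 0"
proof -
  assume "\<bar>k\<bar> > int N"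
  then have "{(a, b). a < N \<and> b < N \<and> int a - int b = k} = {}" by auto
  then show ?thesis by (simp only: fejer_coeff_def) simp
qed

lemma fejer_average_1:
  assumes "N > 0" "N < L"
  shows "(\<Sum>j<L. fejer N (unit_root L j)) / real L = 1"
proof -
  have "complex_of_real ((\<Sum>j<L. fejer N (unit_root L j)) / real L) = complex_of_real 1"
    using fejer_average[of N 0 L 0] assms by (simp add: fejer_coeff_0)
  then show ?thesis by (simp only: of_real_eq_iff)
qed

text \<open>The geometric sum is a quotient with numerator at most 2 and denominator at least
  \<delta> in modulus; squaring gives the constant 4.\<close>

lemma fejer_le:
  assumes "cmod \<zeta> = 1" "cmod (\<zeta> - 1) \<ge> \<delta>" "\<delta> > 0"
  shows "fejer N \<zeta> \<le> 4 / (real N * \<delta>\<^sup>2)"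
proof -
  have "\<zeta> \<noteq> 1" using assms by auto
  have "cmod (\<zeta> ^ N - 1) \<le> cmod (\<zeta> ^ N) + cmod (1::complex)" by (rule norm_triangle_ineq4)
  then have 2: "cmod (\<zeta> ^ N - 1) \<le> 2" using assms(1) by (simp add: norm_power)
  have "cmod (\<Sum>a<N. \<zeta> ^ a) = cmod (\<zeta> ^ N - 1) / cmod (\<zeta> - 1)"
    using \<open>\<zeta> \<noteq> 1\<close> by (simp add: geometric_sum norm_divide)
  also have "\<dots> \<le> 2 / \<delta>" using 2 assms by (intro frac_le) auto
  finally have "(cmod (\<Sum>a<N. \<zeta> ^ a))\<^sup>2 \<le> (2 / \<delta>)\<^sup>2" by (intro power_mono) auto
  then have "fejer N \<zeta> \<le> (2 / \<delta>)\<^sup>2 / real N"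
    unfolding fejer_def by (intro divide_right_mono) auto
  then show ?thesis by (simp add: power_divide mult.commute)
qed

text \<open>Row n of the k-th diagonal has its only entry in column n + k, and none if n + k is
  negative. The explicit formula avoids any limit in defining the mean of B.\<close>

definition fejer_band :: "nat \<Rightarrow> ((nat \<Rightarrow> complex) \<Rightarrow> nat \<Rightarrow> complex) \<Rightarrow> int \<Rightarrow> (nat \<Rightarrow> complex) \<Rightarrow> nat \<Rightarrow> complex"
  where "fejer_band N B k x n = (if int n + k \<ge> 0
    then of_real (fejer_coeff N k) * B (unit_seq (nat (int n + k))) n * x (nat (int n + k)) else 0)"

lemma banded_fejer_band: "banded k (fejer_band N B k)"
  by (auto simp: banded_def fejer_band_def unit_seq_def)

text \<open>The map from n to n + k is injective where it is defined, so a finite section of the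
  shifted sequence consists of finitely many distinct entries of x, apart from zeros.\<close>

lemma shift_ell2:
  assumes x: "x \<in> ell2"
  shows "(\<lambda>n. if int n + k \<ge> 0 then x (nat (int n + k)) else 0) \<in> ell2" (is "?y \<in> _")
    and "ell2_norm (\<lambda>n. if int n + k \<ge> 0 then x (nat (int n + k)) else 0) \<le> ell2_norm x"
proof -
  have le: "L2_set (\<lambda>n. cmod (?y n)) {..<S} \<le> ell2_norm x" for S
  proof -
    let ?T = "{n. n < S \<and> int n + k \<ge> 0}"
    have "(\<Sum>n<S. (cmod (?y n))\<^sup>2) = (\<Sum>n\<in>?T. (cmod (x (nat (int n + k))))\<^sup>2)"
      by (rule sum.mono_neutral_cong_right) auto
    also have "\<dots> = (\<Sum>m\<in>(\<lambda>n. nat (int n + k)) ` ?T. (cmod (x m))\<^sup>2)"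
      by (subst sum.reindex) (auto simp: inj_on_def)
    finally have "L2_set (\<lambda>n. cmod (?y n)) {..<S} = L2_set (\<lambda>n. cmod (x n)) ((\<lambda>n. nat (int n + k)) ` ?T)"
      by (simp add: L2_set_def)
    also have "\<dots> \<le> ell2_norm x" by (intro L2_set_le_ell2_norm x) auto
    finally show ?thesis .
  qed
  show "?y \<in> ell2" "ell2_norm ?y \<le> ell2_norm x"
    using ell2_normI[OF ell2_norm_nonneg[OF x] le] by simp_all
qed

text \<open>A single diagonal is a shift followed by multiplication with a bounded sequence, as each
  matrix entry is at most the norm of B.\<close>

lemma fejer_band_in_ell2_ops:
  assumes B: "B \<in> ell2_ops"
  shows "fejer_band N B k \<in> ell2_ops"
proof -
  define K where "K = fejer_coeff N k * op_norm ell2 ell2_norm B"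
  have c: "fejer_coeff N k \<ge> 0" by (simp add: fejer_coeff_def)
  have b: "cmod (B (unit_seq m) n) \<le> op_norm ell2 ell2_norm B" for m n
    using cmod_le_ell2_norm[OF bounded_opsD(1)[OF B unit_seq_in_ell2]] ell2_op_norm(1)[OF B, of "unit_seq m"]
    by (force intro: order_trans)
  have le: "fejer_band N B k x \<in> ell2 \<and> ell2_norm (fejer_band N B k x) \<le> K * ell2_norm x" if x: "x \<in> ell2" for x
  proof -
    define y where "y n = (if int n + k \<ge> 0 then x (nat (int n + k)) else 0)" for n
    have y: "y \<in> ell2" "ell2_norm y \<le> ell2_norm x"
      unfolding y_def by (rule shift_ell2[OF x])+
    have "K \<ge> 0" unfolding K_def using c ell2_op_norm(2)[OF B] by simp
    have "cmod (fejer_band N B k x n) \<le> cmod (complex_of_real K * y n)" for n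
    proof (cases "int n + k \<ge> 0")
      case True
      have "cmod (fejer_band N B k x n) = fejer_coeff N k * cmod (B (unit_seq (nat (int n + k))) n) * cmod (y n)"
        using True c by (simp add: fejer_band_def y_def norm_mult)
      also have "\<dots> \<le> fejer_coeff N k * op_norm ell2 ell2_norm B * cmod (y n)"
        by (intro mult_right_mono mult_left_mono b c norm_ge_zero)
      finally show ?thesis using \<open>K \<ge> 0\<close> by (simp only: norm_mult norm_of_real K_def[symmetric] abs_of_nonneg)
    qed (simp add: fejer_band_def)
    note * = ell2_mono[OF ell2_scale(1)[OF y(1)] this]
    have "ell2_norm (fejer_band N B k x) \<le> K * ell2_norm y"
      using *(2) \<open>K \<ge> 0\<close> by (simp add: ell2_scale(2)[OF y(1)])
    also have "\<dots> \<le> K * ell2_norm x" using y(2) \<open>K \<ge> 0\<close> by (rule mult_left_mono)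
    finally show ?thesis using *(1) by simp
  qed
  show ?thesis
  proof (rule ell2_opsI[where K = K])
    fix x y :: "nat \<Rightarrow> complex"
    show "fejer_band N B k (\<lambda>n. x n + y n) = (\<lambda>n. fejer_band N B k x n + fejer_band N B k y n)"
      by (auto simp: fejer_band_def algebra_simps)
  next
    fix c and x :: "nat \<Rightarrow> complex"
    show "fejer_band N B k (\<lambda>n. c * x n) = (\<lambda>n. c * fejer_band N B k x n)"
      by (auto simp: fejer_band_def algebra_simps)
  qed (use le in auto)
qed

lemma sum_fejer_band_trunc:
  "(\<Sum>k\<in>{- int N..int N}. fejer_band N B k (trunc S x) n)
    = (\<Sum>m<S. of_real (fejer_coeff N (int m - int n)) * (B (unit_seq m) n * x m))"
proof -
  let ?G = "\<lambda>m. of_real (fejer_coeff N (int m - int n)) * (B (unit_seq m) n * x m)"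
  let ?K = "{k \<in> {- int N..int N}. int n + k \<ge> 0 \<and> nat (int n + k) < S}"
  let ?M = "{m. m < S \<and> \<bar>int m - int n\<bar> \<le> int N}"
  have "(\<Sum>k\<in>{- int N..int N}. fejer_band N B k (trunc S x) n) = (\<Sum>k\<in>?K. ?G (nat (int n + k)))"
    by (rule sum.mono_neutral_cong_right) (auto simp: fejer_band_def trunc_def)
  \<comment> \<open>Row n is reindexed by the column m = n + k; columns farther than N from n can
    then be added since their coefficient is 0.\<close>
  also have "\<dots> = (\<Sum>m\<in>?M. ?G m)"
    by (rule sum.reindex_bij_witness[where i = "\<lambda>m. int m - int n" and j = "\<lambda>k. nat (int n + k)"]) auto
  also have "\<dots> = (\<Sum>m<S. ?G m)"
  proof (rule sum.mono_neutral_left)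
    show "\<forall>m\<in>{..<S} - ?M. ?G m = 0"
    proof
      fix m assume "m \<in> {..<S} - ?M"
      then have "fejer_coeff N (int m - int n) = 0" by (intro fejer_coeff_eq_0) auto
      then show "?G m = 0" by simp
    qed
  qed auto
  finally show ?thesis .
qed

text \<open>On a truncated input every coordinate is a finite matrix sum, so the average moves
  inside to the factor attached to each entry. The two bounds on L keep row n and all columns below
  S in the range where the average is exact.\<close>

lemma fejer_average_twist:
  assumes B: "B \<in> ell2_ops" and "N > 0" "N + n < L" "N + S < L"
  shows "(\<Sum>j<L. complex_of_real (fejer N (unit_root L j)) * twist (unit_root L j) B (trunc S x) n) / of_nat L
    = (\<Sum>k\<in>{- int N..int N}. fejer_band N B k (trunc S x) n)"
proof -
  have tw: "twist \<zeta> B (trunc S x) n = (\<Sum>m<S. (\<zeta> ^ n * cnj \<zeta> ^ m) * (B (unit_seq m) n * x m))" for \<zeta>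
  proof -
    have "modulate (cnj \<zeta>) (trunc S x) = trunc S (modulate (cnj \<zeta>) x)"
      by (auto simp: modulate_def trunc_def)
    then have "twist \<zeta> B (trunc S x) n = \<zeta> ^ n * (\<Sum>m<S. B (unit_seq m) n * modulate (cnj \<zeta>) x m)"
      by (simp add: twist_def modulate_def[of \<zeta>] ell2_ops_trunc[OF B])
    then show ?thesis by (simp add: modulate_def sum_distrib_left mult_ac)
  qed
  have "(\<Sum>j<L. complex_of_real (fejer N (unit_root L j)) * twist (unit_root L j) B (trunc S x) n) / of_nat L
    = (\<Sum>j<L. \<Sum>m<S. complex_of_real (fejer N (unit_root L j)) * (unit_root L j ^ n * cnj (unit_root L j) ^ m) / of_nat L * (B (unit_seq m) n * x m))"
    unfolding tw sum_divide_distrib by (intro sum.cong refl) (simp add: sum_distrib_left sum_divide_distrib mult_ac)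
  also have "\<dots> = (\<Sum>m<S. (\<Sum>j<L. complex_of_real (fejer N (unit_root L j)) * (unit_root L j ^ n * cnj (unit_root L j) ^ m)) / of_nat L * (B (unit_seq m) n * x m))"
    by (subst sum.swap) (simp add: sum_distrib_right sum_divide_distrib)
  also have "\<dots> = (\<Sum>m<S. of_real (fejer_coeff N (int m - int n)) * (B (unit_seq m) n * x m))"
    using assms by (intro sum.cong refl) (subst fejer_average, auto)
  finally show ?thesis by (simp add: sum_fejer_band_trunc)
qed

text \<open>Near 1 the continuity bound \<epsilon> is used; elsewhere the kernel is at most 4 / (N
  \<delta>^2) and the difference at most twice the norm of B, whence 8. Adding both bounds gives one
  estimate for all \<zeta>.\<close>

lemma fejer_twist_bound:
  assumes B: "B \<in> ell2_ops" and "\<epsilon> \<ge> 0" "\<delta> > 0" "N > 0"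
    and close: "\<And>\<zeta>. cmod \<zeta> = 1 \<Longrightarrow> cmod (\<zeta> - 1) < \<delta> \<Longrightarrow> op_norm ell2 ell2_norm (\<lambda>x n. twist \<zeta> B x n - B x n) \<le> \<epsilon>"
    and \<zeta>: "cmod \<zeta> = 1" and x: "x \<in> ell2"
  shows "fejer N \<zeta> * ell2_norm (\<lambda>n. twist \<zeta> B x n - B x n)
    \<le> (fejer N \<zeta> * \<epsilon> + 8 * op_norm ell2 ell2_norm B / (real N * \<delta>\<^sup>2)) * ell2_norm x"
proof -
  let ?b = "op_norm ell2 ell2_norm B" and ?u = "ell2_norm (\<lambda>n. twist \<zeta> B x n - B x n)"
  have b: "?b \<ge> 0" by (rule ell2_op_norm(2)[OF B])
  have nx: "ell2_norm x \<ge> 0" by (rule ell2_norm_nonneg[OF x])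
  note f = fejer_nonneg[of N \<zeta>]
  have tB: "twist \<zeta> B \<in> ell2_ops" by (rule twist_in_ell2_ops[OF B \<zeta>])
  show ?thesis
  proof (cases "cmod (\<zeta> - 1) < \<delta>")
    case True
    have "?u \<le> op_norm ell2 ell2_norm (\<lambda>x n. twist \<zeta> B x n - B x n) * ell2_norm x"
      by (rule ell2_op_norm(1)[OF ell2_ops_minus[OF tB B] x])
    also have "\<dots> \<le> \<epsilon> * ell2_norm x" by (intro mult_right_mono close \<zeta> True nx)
    finally have "fejer N \<zeta> * ?u \<le> fejer N \<zeta> * (\<epsilon> * ell2_norm x)" using f by (rule mult_left_mono)
    moreover have "0 \<le> 8 * ?b / (real N * \<delta>\<^sup>2) * ell2_norm x" using b nx by simp
    ultimately show ?thesis by (simp add: algebra_simps)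
  next
    case False
    have "?u \<le> ell2_norm (twist \<zeta> B x) + ell2_norm (B x)"
      by (intro ell2_diff bounded_opsD(1)[OF tB] bounded_opsD(1)[OF B] x)
    also have "\<dots> \<le> ?b * ell2_norm x + ?b * ell2_norm x"
      by (intro add_mono ell2_norm_twist_le \<zeta> ell2_op_norm(1)[OF B] x)
    finally have "?u \<le> 2 * ?b * ell2_norm x" by (simp add: mult_ac)
    moreover have "fejer N \<zeta> \<le> 4 / (real N * \<delta>\<^sup>2)"
      using False assms by (intro fejer_le) auto
    moreover have "0 \<le> ?u"
      by (intro ell2_norm_nonneg ell2_diff bounded_opsD(1)[OF tB] bounded_opsD(1)[OF B] x)
    ultimately have "fejer N \<zeta> * ?u \<le> 4 / (real N * \<delta>\<^sup>2) * (2 * ?b * ell2_norm x)"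
      by (intro mult_mono) auto
    moreover have "0 \<le> fejer N \<zeta> * \<epsilon> * ell2_norm x" using f nx assms(2) by simp
    ultimately show ?thesis by (simp add: algebra_simps)
  qed
qed

text \<open>The kernel averages to 1, so B itself is such an average and the error is an average of
  \<open>twist \<zeta> B - B\<close>. The triangle inequality in \<open>ell2\<close> bounds it, the
  continuity part collecting total weight 1.\<close>

lemma fejer_mean_trunc_bound:
  assumes B: "B \<in> ell2_ops" and "\<epsilon> \<ge> 0" "\<delta> > 0" "N > 0"
    and close: "\<And>\<zeta>. cmod \<zeta> = 1 \<Longrightarrow> cmod (\<zeta> - 1) < \<delta> \<Longrightarrow> op_norm ell2 ell2_norm (\<lambda>x n. twist \<zeta> B x n - B x n) \<le> \<epsilon>"
  shows "L2_set (\<lambda>n. cmod (B (trunc S x) n - (\<Sum>k\<in>{- int N..int N}. fejer_band N B k (trunc S x) n))) {..<S'}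
    \<le> (\<epsilon> + 8 * op_norm ell2 ell2_norm B / (real N * \<delta>\<^sup>2)) * ell2_norm (trunc S x)"
proof -
  let ?X = "trunc S x" and ?c = "8 * op_norm ell2 ell2_norm B / (real N * \<delta>\<^sup>2)"
  \<comment> \<open>Exceeds N + n for all rows n < S' and N + m for all columns m < S. The bound
    finally obtained is free of L, so S and S' may grow.\<close>
  define L where "L = N + S + S' + 1"
  have L: "L > 0" "N < L" by (simp_all add: L_def)
  define v where "v j = (\<lambda>n. complex_of_real (fejer N (unit_root L j) / real L) * (twist (unit_root L j) B ?X n - B ?X n))" for j
  have X: "?X \<in> ell2" by (rule trunc_in_ell2)
  have d: "(\<lambda>n. twist (unit_root L j) B ?X n - B ?X n) \<in> ell2" for j
    by (intro ell2_diff bounded_opsD(1)[OF B] bounded_opsD(1)[OF twist_in_ell2_ops[OF B]] X) simp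
  have v: "v j \<in> ell2" for j unfolding v_def by (intro ell2_scale d)
  have nv: "ell2_norm (v j) \<le> (fejer N (unit_root L j) * \<epsilon> + ?c) * ell2_norm ?X / real L" for j
  proof -
    have "ell2_norm (v j) = fejer N (unit_root L j) * ell2_norm (\<lambda>n. twist (unit_root L j) B ?X n - B ?X n) / real L"
      unfolding v_def ell2_scale(2)[OF d] norm_of_real using fejer_nonneg[of N "unit_root L j"] by simp
    also have "\<dots> \<le> (fejer N (unit_root L j) * \<epsilon> + ?c) * ell2_norm ?X / real L"
      using assms X by (intro divide_right_mono fejer_twist_bound) auto
    finally show ?thesis .
  qed
  have eq: "B ?X n - (\<Sum>k\<in>{- int N..int N}. fejer_band N B k ?X n) = - (\<Sum>j<L. v j n)" if "n < S'" for n
  proof -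
    have a: "(\<Sum>j<L. complex_of_real (fejer N (unit_root L j)) * twist (unit_root L j) B ?X n) / of_nat L
        = (\<Sum>k\<in>{- int N..int N}. fejer_band N B k ?X n)"
      using that by (intro fejer_average_twist[OF B \<open>N > 0\<close>]) (auto simp: L_def)
    have b: "(\<Sum>j<L. fejer N (unit_root L j)) / real L = 1"
      by (rule fejer_average_1[OF \<open>N > 0\<close> L(2)])
    have "(\<Sum>j<L. v j n) = (\<Sum>j<L. complex_of_real (fejer N (unit_root L j)) * twist (unit_root L j) B ?X n) / of_nat L
        - complex_of_real ((\<Sum>j<L. fejer N (unit_root L j)) / real L) * B ?X n"
      by (simp add: v_def sum_subtractf sum_divide_distrib sum_distrib_right right_diff_distrib diff_divide_distrib)
    then show ?thesis unfolding a b by simp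
  qed
  \<comment> \<open>The identity \<open>eq\<close> covers only the rows below S', so the sections
    are compared there before passing to the full \<open>ell2\<close> norm of the average.\<close>
  have "L2_set (\<lambda>n. cmod (B ?X n - (\<Sum>k\<in>{- int N..int N}. fejer_band N B k ?X n))) {..<S'} = L2_set (\<lambda>n. cmod (\<Sum>j<L. v j n)) {..<S'}"
    by (intro L2_set_cong refl) (simp add: eq)
  also have "\<dots> \<le> ell2_norm (\<lambda>n. \<Sum>j<L. v j n)"
    using ell2_sum[of "{..<L}" v] v by (intro L2_set_le_ell2_norm) auto
  also have "\<dots> \<le> (\<Sum>j<L. ell2_norm (v j))"
    using ell2_sum[of "{..<L}" v] v by simp
  also have "\<dots> \<le> (\<Sum>j<L. (fejer N (unit_root L j) * \<epsilon> + ?c) * ell2_norm ?X / real L)"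
    by (intro sum_mono nv)
  also have "\<dots> = ((\<Sum>j<L. fejer N (unit_root L j)) / real L * \<epsilon> + ?c) * ell2_norm ?X"
    using L by (simp add: sum.distrib sum_distrib_right sum_divide_distrib[symmetric] field_simps) (simp add: sum_distrib_left)
  also have "\<dots> = (\<epsilon> + ?c) * ell2_norm ?X"
    using fejer_average_1[OF \<open>N > 0\<close> L(2)] by simp
  finally show ?thesis .
qed

lemma rotation_continuous_imp_band_approximable:
  assumes B: "B \<in> ell2_ops" and cont: "rotation_continuous B"
  shows "band_approximable B"
  unfolding band_approximable_def
proof (intro allI impI)
  fix \<epsilon> :: real assume "\<epsilon> > 0"
  let ?b = "op_norm ell2 ell2_norm B"
  let ?g = "\<lambda>\<zeta>. op_norm ell2 ell2_norm (\<lambda>x n. twist \<zeta> B x n - B x n)"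
  have "\<forall>\<^sub>F \<zeta> in at 1 within sphere 0 1. ?g \<zeta> < \<epsilon> / 2"
    using cont \<open>\<epsilon> > 0\<close> unfolding rotation_continuous_def by (intro order_tendstoD(2)) auto
  then obtain \<delta> where \<delta>: "\<delta> > 0" "\<And>\<zeta>. \<zeta> \<in> sphere 0 1 \<Longrightarrow> \<zeta> \<noteq> 1 \<Longrightarrow> dist \<zeta> 1 < \<delta> \<Longrightarrow> ?g \<zeta> < \<epsilon> / 2"
    unfolding eventually_at by blast
  have close: "?g \<zeta> \<le> \<epsilon> / 2" if "cmod \<zeta> = 1" "cmod (\<zeta> - 1) < \<delta>" for \<zeta>
  \<comment> \<open>The filter \<open>at 1\<close> leaves out \<zeta> = 1, which occurs among the
    roots of unity; there the difference is the zero operator.\<close>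
  proof (cases "\<zeta> = 1")
    case True
    have "(\<lambda>x n. twist 1 B x n - B x n) = (\<lambda>x n. 0)"
      by (simp add: twist_def modulate_def)
    moreover have "op_norm ell2 ell2_norm (\<lambda>x n. 0) \<le> 0"
      by (rule ell2_op_norm_leI) simp_all
    ultimately show ?thesis using True \<open>\<epsilon> > 0\<close> by simp
  next
    case False
    then show ?thesis using \<delta>(2)[of \<zeta>] that by (simp add: dist_norm)
  qed
  \<comment> \<open>This threshold makes 8 ?b / (N \<delta>^2) at most \<epsilon> / 2; the other
    half is the continuity bound.\<close>
  obtain N :: nat where N: "real N > 16 * ?b / (\<epsilon> * \<delta>\<^sup>2)" "N > 0"
  proof -
    obtain M :: nat where "real M > 16 * ?b / (\<epsilon> * \<delta>\<^sup>2)" using reals_Archimedean2 by blast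
    then show ?thesis by (intro that[of "Suc M"]) auto
  qed
  have "8 * ?b / (real N * \<delta>\<^sup>2) \<le> \<epsilon> / 2"
    using N \<open>\<epsilon> > 0\<close> \<delta>(1) by (simp add: field_simps)
  let ?J = "{- int N..int N}"
  let ?R = "\<lambda>x n. B x n - (\<Sum>k\<in>?J. fejer_band N B k x n)"
  have R: "?R \<in> ell2_ops"
    by (intro ell2_ops_minus B ell2_ops_sum fejer_band_in_ell2_ops) simp
  have "ell2_norm (?R x) \<le> \<epsilon> * ell2_norm x" if x: "x \<in> ell2" for x
  proof (rule ell2_norm_le_trunc[OF R x])
    show "0 \<le> \<epsilon> * ell2_norm x" using \<open>\<epsilon> > 0\<close> ell2_norm_nonneg[OF x] by simp
    fix S S'
    have "L2_set (\<lambda>n. cmod (?R (trunc S x) n)) {..<S'} \<le> (\<epsilon> / 2 + 8 * ?b / (real N * \<delta>\<^sup>2)) * ell2_norm (trunc S x)"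
      using \<open>\<epsilon> > 0\<close> \<delta>(1) N(2) close by (intro fejer_mean_trunc_bound B) auto
    also have "\<dots> \<le> \<epsilon> * ell2_norm x"
      using \<open>8 * ?b / (real N * \<delta>\<^sup>2) \<le> \<epsilon> / 2\<close> \<open>\<epsilon> > 0\<close> ell2_norm_trunc[OF x] ell2_norm_nonneg[OF trunc_in_ell2]
      by (intro mult_mono) auto
    finally show "L2_set (\<lambda>n. cmod (?R (trunc S x) n)) {..<S'} \<le> \<epsilon> * ell2_norm x" .
  qed
  then show "\<exists>K D. finite K \<and> (\<forall>k\<in>K. D k \<in> ell2_ops \<and> banded k (D k)) \<and>
     (\<forall>x\<in>ell2. ell2_norm (\<lambda>n. B x n - (\<Sum>k\<in>K. D k x n)) \<le> \<epsilon> * ell2_norm x)"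
    by (intro exI[of _ ?J] exI[of _ "fejer_band N B"]) (simp add: fejer_band_in_ell2_ops[OF B] banded_fejer_band)
qed

section \<open>Transfer to the Fock space\<close>

text \<open>Removes \<open>inv_into\<close> from view: from here on \<open>matrix_op\<close> is
  handled through expansions alone.\<close>

lemma matrix_op_expands:
  assumes t: "t > 0" and A: "A \<in> fock_ops t" and x: "expands t x f" "x \<in> ell2"
  shows "expands t (matrix_op t A x) (A f)" and "matrix_op t A x \<in> ell2"
proof -
  have f: "f \<in> fock t" using expands_fock_iff[OF t x(1)] x(2) by simp
  have "matrix_op t A x = fock_coords t (A f)"
    by (simp add: matrix_op_def expands_inv_into[OF t x(2,1)])
  then show "expands t (matrix_op t A x) (A f)" "matrix_op t A x \<in> ell2"
    using expands_fock_coords_self[OF t bounded_opsD(1)[OF A f]] by simp_all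
qed

text \<open>Linearity follows from uniqueness of coefficients, both sides expanding the same
  function; the bound is carried over because coordinates preserve norms.\<close>

lemma matrix_op_in_ell2_ops:
  assumes t: "t > 0" and A: "A \<in> fock_ops t"
  shows "matrix_op t A \<in> ell2_ops"
proof -
  have N: "0 \<le> fock_norm t f" if "f \<in> fock t" for f
    using expands_fock_coords_self(2,3)[OF t that] ell2_norm_nonneg by metis
  obtain K where K: "\<And>f. f \<in> fock t \<Longrightarrow> fock_norm t (A f) \<le> K * fock_norm t f"
    using bounded_opsE[OF A N] by blast
  show ?thesis
  proof (rule ell2_opsI[where K = K])
    fix x y assume xy: "x \<in> ell2" "y \<in> ell2"
    obtain f where f: "expands t x f" "f \<in> fock t" using ell2_cases[OF t xy(1)] .
    obtain g where g: "expands t y g" "g \<in> fock t" using ell2_cases[OF t xy(2)] .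
    have "expands t (matrix_op t A (\<lambda>n. x n + y n)) (A (\<lambda>z. f z + g z))"
      by (intro matrix_op_expands t A expands_add f g ell2_add xy)
    moreover have "expands t (\<lambda>n. matrix_op t A x n + matrix_op t A y n) (A (\<lambda>z. f z + g z))"
      unfolding bounded_opsD(2)[OF A f(2) g(2)]
      by (intro expands_add matrix_op_expands t A f g xy)
    ultimately show "matrix_op t A (\<lambda>n. x n + y n) = (\<lambda>n. matrix_op t A x n + matrix_op t A y n)"
      by (rule expands_unique[OF t])
  next
    fix c x assume x: "x \<in> ell2"
    obtain f where f: "expands t x f" "f \<in> fock t" using ell2_cases[OF t x] .
    have "expands t (matrix_op t A (\<lambda>n. c * x n)) (A (\<lambda>z. c * f z))"
      by (intro matrix_op_expands t A expands_scale f ell2_scale x)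
    moreover have "expands t (\<lambda>n. c * matrix_op t A x n) (A (\<lambda>z. c * f z))"
      unfolding bounded_opsD(3)[OF A f(2)]
      by (intro expands_scale matrix_op_expands t A f x)
    ultimately show "matrix_op t A (\<lambda>n. c * x n) = (\<lambda>n. c * matrix_op t A x n)"
      by (rule expands_unique[OF t])
    note Ax = matrix_op_expands[OF t A f(1) x]
    show "matrix_op t A x \<in> ell2" by (rule Ax(2))
    show "ell2_norm (matrix_op t A x) \<le> K * ell2_norm x"
      using K[OF f(2)] by (simp add: expands_fock_norm[OF t Ax] expands_fock_norm[OF t f(1) x])
  qed
qed

text \<open>B is transported back along the coordinate map. Agreement is claimed on
  \<open>ell2\<close> only, since outside it \<open>matrix_op t C\<close> depends on arbitrary
  values of \<open>inv_into\<close>.\<close>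

lemma ex_fock_op_matrix:
  assumes t: "t > 0" and B: "B \<in> ell2_ops"
  obtains C where "C \<in> fock_ops t" "\<And>x. x \<in> ell2 \<Longrightarrow> matrix_op t C x = B x"
proof -
  define C where "C f = inv_into (fock t) (fock_coords t) (B (fock_coords t f))" for f
  have C: "expands t (B x) (C f) \<and> C f \<in> fock t" if "expands t x f" "x \<in> ell2" for x f
    unfolding C_def expands_fock_coords[OF t that]
    by (intro conjI fock_coords_inv_into t bounded_opsD(1)[OF B] that)
  obtain K where K: "\<And>x. x \<in> ell2 \<Longrightarrow> ell2_norm (B x) \<le> K * ell2_norm x"
    using bounded_opsE[OF B ell2_norm_nonneg] by blast
  have "C \<in> fock_ops t"
    unfolding bounded_ops_def
  proof (intro CollectI conjI ballI allI exI)
    fix f assume f: "f \<in> fock t"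
    obtain x where x: "expands t x f" "x \<in> ell2" using fock_cases[OF t f] .
    show "C f \<in> fock t" using C[OF x] by simp
    have "expands t (B x) (C f)" using C[OF x] by simp
    from expands_fock_norm[OF t this bounded_opsD(1)[OF B x(2)]]
    show "fock_norm t (C f) \<le> K * fock_norm t f"
      using K[OF x(2)] by (simp add: expands_fock_norm[OF t x])
    fix c
    have "expands t (B (\<lambda>n. c * x n)) (C (\<lambda>z. c * f z))"
      using C[OF expands_scale[OF x(1)] ell2_scale(1)[OF x(2)]] by blast
    moreover have "expands t (\<lambda>n. c * B x n) (\<lambda>z. c * C f z)"
      using C[OF x] by (intro expands_scale) simp
    ultimately show "C (\<lambda>z. c * f z) = (\<lambda>z. c * C f z)"
      unfolding bounded_opsD(3)[OF B x(2)] by (rule expands_unique_fun)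
  next
    fix f g assume f: "f \<in> fock t" and g: "g \<in> fock t"
    obtain x where x: "expands t x f" "x \<in> ell2" using fock_cases[OF t f] .
    obtain y where y: "expands t y g" "y \<in> ell2" using fock_cases[OF t g] .
    have "expands t (B (\<lambda>n. x n + y n)) (C (\<lambda>z. f z + g z))"
      using C[OF expands_add[OF x(1) y(1)] ell2_add(1)[OF x(2) y(2)]] by blast
    moreover have "expands t (\<lambda>n. B x n + B y n) (\<lambda>z. C f z + C g z)"
      using C[OF x] C[OF y] by (intro expands_add) simp_all
    ultimately show "C (\<lambda>z. f z + g z) = (\<lambda>z. C f z + C g z)"
      unfolding bounded_opsD(2)[OF B x(2) y(2)] by (rule expands_unique_fun)
  qed
  moreover have "matrix_op t C x = B x" if x: "x \<in> ell2" for x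
  proof -
    obtain f where f: "expands t x f" "f \<in> fock t" using ell2_cases[OF t x] .
    show ?thesis
      using matrix_op_expands(1)[OF t \<open>C \<in> fock_ops t\<close> f(1) x] C[OF f(1) x] expands_unique[OF t] by blast
  qed
  ultimately show ?thesis by (rule that)
qed

lemma matrix_op_unit_seq:
  assumes t: "t > 0"
  shows "matrix_op t C (unit_seq m) n = fock_inner t (C (fock_basis t m)) (fock_basis t n)"
  by (simp add: matrix_op_def fock_coords_def expands_inv_into[OF t unit_seq_in_ell2 expands_fock_basis])

lemma band_iff:
  assumes t: "t > 0"
  shows "D \<in> band t k \<longleftrightarrow> (\<exists>C\<in>fock_ops t. D = matrix_op t C \<and> banded k (matrix_op t C))"
  by (auto simp: band_def banded_def matrix_op_unit_seq[OF t])

text \<open>From \<open>BDO\<close> one only forgets structure. Conversely the approximating D k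
  need not have the form \<open>matrix_op t C\<close> as functions, so they are replaced by
  operators of this form with the same values on \<open>ell2\<close>.\<close>

lemma matrix_op_in_BDO_iff:
  assumes t: "t > 0" and A: "A \<in> fock_ops t"
  shows "matrix_op t A \<in> BDO t \<longleftrightarrow> band_approximable (matrix_op t A)"
proof
  let ?B = "matrix_op t A"
  note B = matrix_op_in_ell2_ops[OF t A]
  assume BDO: "?B \<in> BDO t"
  show "band_approximable ?B"
    unfolding band_approximable_def
  proof (intro allI impI)
    fix \<epsilon> :: real assume "\<epsilon> > 0"
    with BDO obtain E where E: "E \<in> band_operators t" "op_norm ell2 ell2_norm (\<lambda>x n. ?B x n - E x n) < \<epsilon>"
      unfolding BDO_def by blast
    then obtain K D where KD: "finite K" "\<And>k. k \<in> K \<Longrightarrow> D k \<in> band t k" "E = (\<lambda>x n. \<Sum>k\<in>K. D k x n)"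
      unfolding band_operators_def by blast
    have D: "D k \<in> ell2_ops \<and> banded k (D k)" if "k \<in> K" for k
      using KD(2)[OF that] matrix_op_in_ell2_ops[OF t] by (auto simp: band_iff[OF t])
    have R: "(\<lambda>x n. ?B x n - E x n) \<in> ell2_ops"
      unfolding KD(3) using D by (intro ell2_ops_minus B ell2_ops_sum KD) simp
    have "ell2_norm (\<lambda>n. ?B x n - E x n) \<le> \<epsilon> * ell2_norm x" if "x \<in> ell2" for x
    proof -
      have "ell2_norm (\<lambda>n. ?B x n - E x n) \<le> op_norm ell2 ell2_norm (\<lambda>x n. ?B x n - E x n) * ell2_norm x"
        by (rule ell2_op_norm(1)[OF R that])
      also have "\<dots> \<le> \<epsilon> * ell2_norm x"
        using E(2) ell2_norm_nonneg[OF that] by (intro mult_right_mono) auto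
      finally show ?thesis .
    qed
    then show "\<exists>K D. finite K \<and> (\<forall>k\<in>K. D k \<in> ell2_ops \<and> banded k (D k)) \<and>
       (\<forall>x\<in>ell2. ell2_norm (\<lambda>n. ?B x n - (\<Sum>k\<in>K. D k x n)) \<le> \<epsilon> * ell2_norm x)"
      unfolding KD(3) using KD(1) D by (intro exI[of _ K] exI[of _ D]) simp
  qed
next
  let ?B = "matrix_op t A"
  assume appr: "band_approximable ?B"
  have "\<exists>E\<in>band_operators t. op_norm ell2 ell2_norm (\<lambda>x n. ?B x n - E x n) < \<epsilon>" if "\<epsilon> > 0" for \<epsilon>
  proof -
    \<comment> \<open>Half of \<epsilon> makes the final inequality strict.\<close>
    have "\<epsilon> / 2 > 0" using that by simp
    note ex = appr[unfolded band_approximable_def, rule_format, OF this]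
    obtain K D where KD: "finite K \<and> (\<forall>k\<in>K. D k \<in> ell2_ops \<and> banded k (D k)) \<and>
       (\<forall>x\<in>ell2. ell2_norm (\<lambda>n. ?B x n - (\<Sum>k\<in>K. D k x n)) \<le> \<epsilon> / 2 * ell2_norm x)"
      using ex by (elim exE)
    have "\<exists>D'. D' \<in> band t k \<and> (\<forall>x\<in>ell2. D' x = D k x)" if "k \<in> K" for k
    proof -
      have D: "D k \<in> ell2_ops" "banded k (D k)" using KD that by simp_all
      obtain C where C: "C \<in> fock_ops t" "\<And>x. x \<in> ell2 \<Longrightarrow> matrix_op t C x = D k x"
        using ex_fock_op_matrix[OF t D(1)] by blast
      have "banded k (matrix_op t C)"
        using D(2) by (simp add: banded_def C(2))
      then have "matrix_op t C \<in> band t k"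
        using C(1) by (auto simp: band_iff[OF t])
      then show ?thesis using C(2) by blast
    qed
    then obtain D' where D': "\<And>k. k \<in> K \<Longrightarrow> D' k \<in> band t k" "\<And>k x. k \<in> K \<Longrightarrow> x \<in> ell2 \<Longrightarrow> D' k x = D k x"
      by metis
    let ?E = "\<lambda>x n. \<Sum>k\<in>K. D' k x n"
    have "op_norm ell2 ell2_norm (\<lambda>x n. ?B x n - ?E x n) \<le> \<epsilon> / 2"
    proof (rule ell2_op_norm_leI)
      fix x :: "nat \<Rightarrow> complex" assume x: "x \<in> ell2"
      then show "ell2_norm (\<lambda>n. ?B x n - ?E x n) \<le> \<epsilon> / 2 * ell2_norm x"
        using KD by (simp add: D'(2))
    qed (use that in simp)
    moreover have "?E \<in> band_operators t"
      unfolding band_operators_def using KD D'(1) by blast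
    ultimately show ?thesis using that by (intro bexI[of _ ?E]) auto
  qed
  then show "?B \<in> BDO t"
    using matrix_op_in_ell2_ops[OF t A] by (simp add: BDO_def)
qed

text \<open>Both suprema range over the same set of reals: coordinates match the two unit balls, and
  on matching vectors the two differences have equal norms.\<close>

lemma op_norm_rot_conj:
  assumes t: "t > 0" and A: "A \<in> fock_ops t" and \<zeta>: "cmod \<zeta> = 1"
  shows "op_norm (fock t) (fock_norm t) (\<lambda>f z. rot \<zeta> (A (adjoint_op (fock t) (fock_inner t) (rot \<zeta>) f)) z - A f z)
    = op_norm ell2 ell2_norm (\<lambda>x n. twist \<zeta> (matrix_op t A) x n - matrix_op t A x n)"
proof -
  let ?B = "matrix_op t A"
  let ?T = "\<lambda>f z. rot \<zeta> (A (adjoint_op (fock t) (fock_inner t) (rot \<zeta>) f)) z - A f z"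
  let ?S = "\<lambda>x n. twist \<zeta> ?B x n - ?B x n"
  note B = matrix_op_in_ell2_ops[OF t A]
  have R: "?S \<in> ell2_ops" by (intro ell2_ops_minus twist_in_ell2_ops B \<zeta>)
  have eq: "fock_norm t (?T f) = ell2_norm (?S x)" if x: "expands t x f" "x \<in> ell2" for x f
  proof -
    have f: "f \<in> fock t" using expands_fock_iff[OF t x(1)] x(2) by simp
    have "expands t (modulate (cnj \<zeta>) x) (rot (cnj \<zeta>) f)"
      unfolding modulate_def by (rule expands_rot[OF x(1)])
    moreover have "modulate (cnj \<zeta>) x \<in> ell2" using x(2) \<zeta> by (simp add: modulate_ell2)
    ultimately have "expands t (?B (modulate (cnj \<zeta>) x)) (A (rot (cnj \<zeta>) f))"
      by (rule matrix_op_expands(1)[OF t A])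
    then have "expands t (twist \<zeta> ?B x) (rot \<zeta> (A (rot (cnj \<zeta>) f)))"
      unfolding twist_def modulate_def[of \<zeta>] by (rule expands_rot)
    from expands_add[OF this expands_scale[OF matrix_op_expands(1)[OF t A x], of "-1"]]
    have "expands t (?S x) (?T f)"
      by (simp add: adjoint_rot[OF t \<zeta> f])
    then show ?thesis
      by (rule expands_fock_norm[OF t _ bounded_opsD(1)[OF R x(2)]])
  qed
  have "(\<lambda>f. fock_norm t (?T f)) ` {f \<in> fock t. fock_norm t f \<le> 1} = (\<lambda>x. ell2_norm (?S x)) ` {x \<in> ell2. ell2_norm x \<le> 1}"
  proof (intro equalityI image_subsetI)
    fix f assume f: "f \<in> {f \<in> fock t. fock_norm t f \<le> 1}"
    obtain x where x: "expands t x f" "x \<in> ell2" using fock_cases[OF t] f by blast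
    show "fock_norm t (?T f) \<in> (\<lambda>x. ell2_norm (?S x)) ` {x \<in> ell2. ell2_norm x \<le> 1}"
      using f x expands_fock_norm[OF t x] by (intro image_eqI[of _ _ x] eq) simp_all
  next
    fix x :: "nat \<Rightarrow> complex" assume x: "x \<in> {x \<in> ell2. ell2_norm x \<le> 1}"
    obtain f where f: "expands t x f" "f \<in> fock t" using ell2_cases[OF t] x by blast
    have xe: "x \<in> ell2" using x by simp
    show "ell2_norm (?S x) \<in> (\<lambda>f. fock_norm t (?T f)) ` {f \<in> fock t. fock_norm t f \<le> 1}"
      using f x expands_fock_norm[OF t f(1) xe] by (intro image_eqI[of _ _ f] eq[symmetric]) simp_all
  qed
  then show ?thesis unfolding op_norm_def by simp
qed

lemma C_R_iff_rotation_continuous: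
  assumes t: "t > 0" and A: "A \<in> fock_ops t"
  shows "A \<in> C_R t \<longleftrightarrow> rotation_continuous (matrix_op t A)"
proof -
  have "\<forall>\<^sub>F \<zeta> in at 1 within sphere 0 1. cmod \<zeta> = 1"
    by (simp add: eventually_at_filter)
  then have "\<forall>\<^sub>F \<zeta> in at 1 within sphere 0 1.
      op_norm (fock t) (fock_norm t) (\<lambda>f z. rot \<zeta> (A (adjoint_op (fock t) (fock_inner t) (rot \<zeta>) f)) z - A f z)
    = op_norm ell2 ell2_norm (\<lambda>x n. twist \<zeta> (matrix_op t A) x n - matrix_op t A x n)"
    by eventually_elim (rule op_norm_rot_conj[OF t A])
  from tendsto_cong[OF this] A show ?thesis
    by (simp add: C_R_def rotation_continuous_def)
qed

theorem theorem2p3: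
  fixes t :: real and A :: "(complex \<Rightarrow> complex) \<Rightarrow> (complex \<Rightarrow> complex)"
  assumes "t > 0" and "A \<in> fock_ops t"
  shows "A \<in> C_R t \<longleftrightarrow> matrix_op t A \<in> BDO t"
  using rotation_continuous_imp_band_approximable band_approximable_imp_rotation_continuous
    matrix_op_in_ell2_ops[OF assms]
  unfolding C_R_iff_rotation_continuous[OF assms] matrix_op_in_BDO_iff[OF assms] by blast

end
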